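(* Let $G$ be a finite group, and let $\mu$, $\nu$ and $\tau$ be three elements of $\Lambda_G$. The generating function $h^{\tau}_{\mu,\nu}(\beta)=\sum_{r}h_\tau(\mu,\nu;r)\,\beta^r$ is given by the formula $$h^{\tau}_{\mu,\nu}(\beta)=\frac{1}{Z_\tau}\,\frac{\mathrm{tr}(f_{\mu^{-1}}f_\mu)\,\mathrm{tr}(f_{\nu^{-1}}f_\nu)}{\# G}\int_{Z\mathbb C[G]} z_\mu\,\bar z_\nu\, e^{-\langle A_\tau(\beta)z,z\rangle}\,dm,$$ where $Z_\tau$ denotes the value of the integral $$Z_\tau=\int_{Z\mathbb C[G]}e^{-\langle A_\tau(\beta)z,z\rangle}\,dm .$$
   Context: $G$ is a finite group, $\Lambda_G$ is its set of conjugacy classes, and $\mu^{-1}$ denotes the conjugacy class of the inverses of the elements of $\mu$. $Z\mathbb C[G]$ is the center of the complex group algebra (complex-valued functions on $G$ under convolution), with standard basis $\{f_\mu\}_{\mu\in\Lambda_G}$, where $f_\mu$ is the characteristic function of $\mu\subset G$. The trace $\mathrm{tr}\colon Z\mathbb C[G]\to\mathbb C$ is the linear functional with $\mathrm{tr}(f_\mu)=1$ if $\mu=(1)$ is the class of the unit element and $\mathrm{tr}(f_\mu)=0$ otherwise. $\langle\cdot,\cdot\rangle$ is the Hermitian product on $Z\mathbb C[G]$ for which the basis $\{f_\mu\}_{\mu\in\Lambda_G}$ is orthonormal; $z_\mu$ is the coordinate corresponding to the basis element $f_\mu$, and $dm=\prod_{\mu\in\Lambda_G}d\,\mathrm{Re}\,z_\mu\,d\,\mathrm{Im}\,z_\mu$.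 $A_\tau(\beta)$ is the linear endomorphism of $Z\mathbb C[G]$ represented in the standard basis by the matrix with entries $(A_\tau)_{\mu,\nu}(\beta)=\mathrm{tr}(f_{\mu^{-1}}f_\nu(1-\beta f_\tau))$ for $\mu,\nu\in\Lambda_G$. This matrix is non-degenerate for $\beta$ in a neighborhood of $0$, and the integrals are considered for $\beta$ in a neighborhood of $0$. For $r+2$ fixed points $q_0,\dots,q_{r+1}$ on $\mathbb CP^1$, $h_\tau(\mu,\nu;r)$ is the weighted number of principal $G$-bundles over $\mathbb CP^1$ with a non-trivial holonomy around $q_0,\dots,q_{r+1}$, such that the holonomy around $q_0$ is in $\mu$, the holonomy around $q_{r+1}$ is in $\nu$, and the holonomy around each of the other points $q_1,\dots,q_r$ is in the fixed class $\tau$. Bundles are counted up to equivalence, each with weight the reciprocal of the order of its automorphism group. This number is computed as the number of homomorphisms from the fundamental group of the $(r+2)$-times punctured sphere to $G$ such that the image of the element corresponding to a complete revolution around each $q_i$ lies in the conjugacy class prescribed at $q_i$, divided by $\#G$.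
   Formalization: The revolution around q_0 is taken with orientation opposite to those around the other points (c_0 = c_1⋯c_{r+1}), i.e. μ at q_0 is replaced by μ^{-1}; with uniform orientation the formula fails for non-real μ (e.g. G = Z/3, μ = ν = {g}, r = 0). *)

theory Defs
  imports "HOL-Analysis.Analysis" "HOL-Algebra.Group_Action"
begin

section \<open>The center of the group algebra\<close>

definition conj_classes :: "('a, 'b) monoid_scheme \<Rightarrow> 'a set set" where
  "conj_classes G =
     orbits G (carrier G) (\<lambda>g. \<lambda>h \<in> carrier G. g \<otimes>\<^bsub>G\<^esub> h \<otimes>\<^bsub>G\<^esub> inv\<^bsub>G\<^esub> g)"

definition inv_class :: "('a, 'b) monoid_scheme \<Rightarrow> 'a set \<Rightarrow> 'a set" where
  "inv_class G \<mu> = m_inv G ` \<mu>"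

text \<open>Complex functions on the carrier are represented by functions on the ambient type that
  vanish outside the carrier.\<close>

definition group_algebra :: "('a, 'b) monoid_scheme \<Rightarrow> ('a \<Rightarrow> complex) set" where
  "group_algebra G = {\<phi>. \<forall>g. g \<notin> carrier G \<longrightarrow> \<phi> g = 0}"

definition conv ::
  "('a, 'b) monoid_scheme \<Rightarrow> ('a \<Rightarrow> complex) \<Rightarrow> ('a \<Rightarrow> complex) \<Rightarrow> 'a \<Rightarrow> complex" where
  "conv G \<phi> \<psi> = (\<lambda>g. if g \<in> carrier G
      then \<Sum>h\<in>carrier G. \<phi> h * \<psi> (inv\<^bsub>G\<^esub> h \<otimes>\<^bsub>G\<^esub> g) else 0)"

definition center_algebra :: "('a, 'b) monoid_scheme \<Rightarrow> ('a \<Rightarrow> complex) set" where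
  "center_algebra G = {\<phi> \<in> group_algebra G. \<forall>\<psi>\<in>group_algebra G. conv G \<phi> \<psi> = conv G \<psi> \<phi>}"

abbreviation class_fun :: "'a set \<Rightarrow> 'a \<Rightarrow> complex" where
  "class_fun \<mu> \<equiv> indicator \<mu>"

definition lin_comb :: "('a, 'b) monoid_scheme \<Rightarrow> ('a set \<Rightarrow> complex) \<Rightarrow> 'a \<Rightarrow> complex" where
  "lin_comb G c = (\<lambda>g. \<Sum>\<mu>\<in>conj_classes G. c \<mu> * class_fun \<mu> g)"

text \<open>An element of the center is constant on \<open>\<mu>\<close>, so its image of \<open>\<mu>\<close> is a singleton, and
  its only element is the coordinate; see \<open>coord_lin_comb\<close> and \<open>lin_comb_coord\<close> below.\<close>

definition coord :: "'a set \<Rightarrow> ('a \<Rightarrow> complex) \<Rightarrow> complex" where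
  "coord \<mu> z = the_elem (z ` \<mu>)"

definition tr :: "('a, 'b) monoid_scheme \<Rightarrow> ('a \<Rightarrow> complex) \<Rightarrow> complex" where
  "tr G z = (\<Sum>\<mu>\<in>conj_classes G. coord \<mu> z * (if \<mu> = {\<one>\<^bsub>G\<^esub>} then 1 else 0))"

text \<open>Linear in the first argument, conjugate-linear in the second.\<close>

definition herm :: "('a, 'b) monoid_scheme \<Rightarrow> ('a \<Rightarrow> complex) \<Rightarrow> ('a \<Rightarrow> complex) \<Rightarrow> complex" where
  "herm G z w = (\<Sum>\<mu>\<in>conj_classes G. coord \<mu> z * cnj (coord \<mu> w))"

definition A_matrix ::
  "('a, 'b) monoid_scheme \<Rightarrow> 'a set \<Rightarrow> complex \<Rightarrow> 'a set \<Rightarrow> 'a set \<Rightarrow> complex" where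
  "A_matrix G \<tau> \<beta> \<mu> \<nu> =
     tr G (conv G (conv G (class_fun (inv_class G \<mu>)) (class_fun \<nu>))
                  (\<lambda>g. class_fun {\<one>\<^bsub>G\<^esub>} g - \<beta> * class_fun \<tau> g))"

definition A_endo ::
  "('a, 'b) monoid_scheme \<Rightarrow> 'a set \<Rightarrow> complex \<Rightarrow> ('a \<Rightarrow> complex) \<Rightarrow> 'a \<Rightarrow> complex" where
  "A_endo G \<tau> \<beta> z =
     lin_comb G (\<lambda>\<mu>. \<Sum>\<nu>\<in>conj_classes G. A_matrix G \<tau> \<beta> \<mu> \<nu> * coord \<nu> z)"

text \<open>The measure \<open>dm\<close>: the product over all classes of the Lebesgue measures on the complex
  plane, transported to the center along the coordinate isomorphism.
  Its underlying space is the center, see \<open>space_dm\<close> below.\<close>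

definition dm :: "('a, 'b) monoid_scheme \<Rightarrow> ('a \<Rightarrow> complex) measure" where
  "dm G = embed_measure (\<Pi>\<^sub>M \<mu>\<in>conj_classes G. lborel) (lin_comb G)"

definition gauss ::
  "('a, 'b) monoid_scheme \<Rightarrow> 'a set \<Rightarrow> complex \<Rightarrow> ('a \<Rightarrow> complex) \<Rightarrow> complex" where
  "gauss G \<tau> \<beta> z = exp (- herm G (A_endo G \<tau> \<beta> z) z)"

definition partition_fun :: "('a, 'b) monoid_scheme \<Rightarrow> 'a set \<Rightarrow> complex \<Rightarrow> complex" where
  "partition_fun G \<tau> \<beta> = (LINT z|dm G. gauss G \<tau> \<beta> z)"


text \<open>The coordinates are the expected ones, the class functions form a basis of the center, and
  the underlying space of \<open>dm\<close> is the center.\<close>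

lemma conj_class_eq:
  assumes "group G" "\<mu> \<in> conj_classes G" "x \<in> \<mu>"
  shows "\<mu> = {g \<otimes>\<^bsub>G\<^esub> x \<otimes>\<^bsub>G\<^esub> inv\<^bsub>G\<^esub> g | g. g \<in> carrier G}" and "x \<in> carrier G"
proof -
  interpret group G by fact
  interpret group_action G "carrier G" "\<lambda>g. \<lambda>h \<in> carrier G. g \<otimes>\<^bsub>G\<^esub> h \<otimes>\<^bsub>G\<^esub> inv\<^bsub>G\<^esub> g"
    by (rule action_by_conjugation)
  show x: "x \<in> carrier G"
    using assms orbits_coverture by (auto simp: conj_classes_def)
  obtain y where y: "y \<in> carrier G"
    "\<mu> = orbit G (\<lambda>g. \<lambda>h \<in> carrier G. g \<otimes>\<^bsub>G\<^esub> h \<otimes>\<^bsub>G\<^esub> inv\<^bsub>G\<^esub> g) y"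
    using assms(2) by (auto simp: conj_classes_def orbits_def)
  have "orbit G (\<lambda>g. \<lambda>h \<in> carrier G. g \<otimes>\<^bsub>G\<^esub> h \<otimes>\<^bsub>G\<^esub> inv\<^bsub>G\<^esub> g) x \<in> conj_classes G"
    using x by (auto simp: conj_classes_def orbits_def)
  moreover have "x \<in> orbit G (\<lambda>g. \<lambda>h \<in> carrier G. g \<otimes>\<^bsub>G\<^esub> h \<otimes>\<^bsub>G\<^esub> inv\<^bsub>G\<^esub> g) x"
    using x by (rule orbit_refl)
  ultimately have "\<mu> = orbit G (\<lambda>g. \<lambda>h \<in> carrier G. g \<otimes>\<^bsub>G\<^esub> h \<otimes>\<^bsub>G\<^esub> inv\<^bsub>G\<^esub> g) x"
    using assms disjoint_union[of \<mu>] unfolding conj_classes_def by blast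
  then show "\<mu> = {g \<otimes>\<^bsub>G\<^esub> x \<otimes>\<^bsub>G\<^esub> inv\<^bsub>G\<^esub> g | g. g \<in> carrier G}"
    using x by (auto simp: orbit_def)
qed

lemma conj_classes_facts:
  assumes "group G"
  shows "\<Union> (conj_classes G) = carrier G"
    and "\<lbrakk>\<mu> \<in> conj_classes G; \<nu> \<in> conj_classes G; x \<in> \<mu>; x \<in> \<nu>\<rbrakk> \<Longrightarrow> \<mu> = \<nu>"
    and "\<mu> \<in> conj_classes G \<Longrightarrow> \<mu> \<noteq> {}"
    and "{\<one>\<^bsub>G\<^esub>} \<in> conj_classes G"
    and "finite (carrier G) \<Longrightarrow> finite (conj_classes G)"
proof -
  interpret group G by fact
  interpret group_action G "carrier G" "\<lambda>g. \<lambda>h \<in> carrier G. g \<otimes>\<^bsub>G\<^esub> h \<otimes>\<^bsub>G\<^esub> inv\<^bsub>G\<^esub> g"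
    by (rule action_by_conjugation)
  show un: "\<Union> (conj_classes G) = carrier G"
    unfolding conj_classes_def by (rule orbits_coverture)
  show "\<lbrakk>\<mu> \<in> conj_classes G; \<nu> \<in> conj_classes G; x \<in> \<mu>; x \<in> \<nu>\<rbrakk> \<Longrightarrow> \<mu> = \<nu>"
    using disjoint_union[of \<mu> \<nu>] unfolding conj_classes_def by blast
  show "\<mu> \<in> conj_classes G \<Longrightarrow> \<mu> \<noteq> {}"
    using orbit_refl by (auto simp: conj_classes_def orbits_def)
  obtain \<mu> where \<mu>: "\<mu> \<in> conj_classes G" "\<one>\<^bsub>G\<^esub> \<in> \<mu>" using un one_closed by blast
  have "y = \<one>\<^bsub>G\<^esub>" if "y \<in> \<mu>" for y
  proof -
    have "y \<in> {g \<otimes>\<^bsub>G\<^esub> \<one>\<^bsub>G\<^esub> \<otimes>\<^bsub>G\<^esub> inv\<^bsub>G\<^esub> g | g. g \<in> carrier G}"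
      using that conj_class_eq(1)[OF assms \<mu>] by metis
    then show ?thesis by auto
  qed
  then have "\<mu> = {\<one>\<^bsub>G\<^esub>}" using \<mu>(2) by blast
  with \<mu> show "{\<one>\<^bsub>G\<^esub>} \<in> conj_classes G" by simp
  show "finite (conj_classes G)" if "finite (carrier G)"
    using un that by (metis finite_UnionD)
qed

lemma lin_comb_eval:
  assumes "group G" "finite (carrier G)" "\<mu> \<in> conj_classes G" "x \<in> \<mu>"
  shows "lin_comb G c x = c \<mu>"
proof -
  have "lin_comb G c x = (\<Sum>\<nu>\<in>conj_classes G. if \<nu> = \<mu> then c \<mu> else 0)"
    unfolding lin_comb_def using conj_classes_facts(2)[OF assms(1)] assms(3,4)
    by (intro sum.cong) (auto simp: indicator_def)
  then show ?thesis using conj_classes_facts(5)[OF assms(1,2)] assms(3) by simp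
qed

lemma coord_lin_comb:
  assumes "group G" "finite (carrier G)" "\<mu> \<in> conj_classes G"
  shows "coord \<mu> (lin_comb G c) = c \<mu>"
proof -
  have "lin_comb G c ` \<mu> = {c \<mu>}"
    using lin_comb_eval[OF assms] conj_classes_facts(3)[OF assms(1,3)] by auto
  then show ?thesis by (simp add: coord_def)
qed

lemma center_algebra_const:
  assumes "group G" "finite (carrier G)" "z \<in> center_algebra G" "x \<in> carrier G" "g \<in> carrier G"
  shows "z (g \<otimes>\<^bsub>G\<^esub> x \<otimes>\<^bsub>G\<^esub> inv\<^bsub>G\<^esub> g) = z x"
proof -
  interpret group G by fact
  let ?y = "g \<otimes>\<^bsub>G\<^esub> x"
  have y: "?y \<in> carrier G" using assms by simp
  have "indicator {g} \<in> group_algebra G" using assms by (auto simp: group_algebra_def indicator_def)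
  then have eq: "conv G z (indicator {g}) ?y = conv G (indicator {g}) z ?y"
    using assms(3) by (simp add: center_algebra_def)
  have "inv\<^bsub>G\<^esub> h \<otimes>\<^bsub>G\<^esub> ?y = g \<longleftrightarrow> h = ?y \<otimes>\<^bsub>G\<^esub> inv\<^bsub>G\<^esub> g" if "h \<in> carrier G" for h
    using that assms(4,5) y
    by (metis inv_closed inv_equality inv_solve_left inv_solve_right m_closed)
  then have "conv G z (indicator {g}) ?y =
      (\<Sum>h\<in>carrier G. if h = ?y \<otimes>\<^bsub>G\<^esub> inv\<^bsub>G\<^esub> g then z h else 0)"
    using y unfolding conv_def by (auto intro!: sum.cong simp: indicator_def)
  then have 1: "conv G z (indicator {g}) ?y = z (?y \<otimes>\<^bsub>G\<^esub> inv\<^bsub>G\<^esub> g)"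
    using assms by simp
  have "conv G (indicator {g}) z ?y =
      (\<Sum>h\<in>carrier G. if h = g then z (inv\<^bsub>G\<^esub> g \<otimes>\<^bsub>G\<^esub> ?y) else 0)"
    using y unfolding conv_def by (auto intro!: sum.cong simp: indicator_def)
  then have 2: "conv G (indicator {g}) z ?y = z x"
    using assms by (simp add: m_assoc[symmetric])
  show ?thesis using eq 1 2 by simp
qed

lemma lin_comb_coord:
  assumes "group G" "finite (carrier G)" "z \<in> center_algebra G"
  shows "lin_comb G (\<lambda>\<mu>. coord \<mu> z) = z"
proof
  fix x
  show "lin_comb G (\<lambda>\<mu>. coord \<mu> z) x = z x"
  proof (cases "x \<in> carrier G")
    case True
    then obtain \<mu> where \<mu>: "\<mu> \<in> conj_classes G" "x \<in> \<mu>"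
      using conj_classes_facts(1)[OF assms(1)] by blast
    have "z y = z x" if "y \<in> \<mu>" for y
      using that conj_class_eq(1)[OF assms(1) \<mu>] center_algebra_const[OF assms True] by auto
    then have "z ` \<mu> = {z x}" using \<mu>(2) by (intro equalityI subsetI) blast+
    then have "coord \<mu> z = z x" by (simp add: coord_def)
    then show ?thesis using lin_comb_eval[OF assms(1,2) \<mu>] by simp
  next
    case False
    then have "x \<notin> \<mu>" if "\<mu> \<in> conj_classes G" for \<mu>
      using that conj_classes_facts(1)[OF assms(1)] by blast
    then have "lin_comb G (\<lambda>\<mu>. coord \<mu> z) x = 0"
      unfolding lin_comb_def by (intro sum.neutral) (simp add: indicator_def)
    then show ?thesis using False assms(3) by (simp add: center_algebra_def group_algebra_def)
  qed
qed

lemma lin_comb_in_center: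
  assumes "group G" "finite (carrier G)"
  shows "lin_comb G c \<in> center_algebra G"
proof -
  interpret group G by fact
  let ?z = "lin_comb G c"
  have inA: "?z \<in> group_algebra G"
  proof -
    have "?z x = 0" if "x \<notin> carrier G" for x
      unfolding lin_comb_def using that conj_classes_facts(1)[OF assms(1)]
      by (intro sum.neutral) (auto simp: indicator_def)
    then show ?thesis by (simp add: group_algebra_def)
  qed
  have inv: "?z (g \<otimes>\<^bsub>G\<^esub> x \<otimes>\<^bsub>G\<^esub> inv\<^bsub>G\<^esub> g) = ?z x" if x: "x \<in> carrier G" and g: "g \<in> carrier G" for x g
  proof -
    obtain \<mu> where \<mu>: "\<mu> \<in> conj_classes G" "x \<in> \<mu>"
      using x conj_classes_facts(1)[OF assms(1)] by blast
    have "g \<otimes>\<^bsub>G\<^esub> x \<otimes>\<^bsub>G\<^esub> inv\<^bsub>G\<^esub> g \<in> \<mu>"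
      by (subst conj_class_eq(1)[OF assms(1) \<mu>]) (use g in blast)
    then show ?thesis by (simp only: lin_comb_eval[OF assms \<mu>(1)] \<mu>(2))
  qed
  have "conv G ?z \<psi> x = conv G \<psi> ?z x" for \<psi> x
  proof (cases "x \<in> carrier G")
    case True
    have "(\<Sum>h\<in>carrier G. ?z h * \<psi> (inv\<^bsub>G\<^esub> h \<otimes>\<^bsub>G\<^esub> x)) =
        (\<Sum>k\<in>carrier G. \<psi> k * ?z (inv\<^bsub>G\<^esub> k \<otimes>\<^bsub>G\<^esub> x))"
    proof (rule sum.reindex_bij_witness
        [where i = "\<lambda>k. x \<otimes>\<^bsub>G\<^esub> inv\<^bsub>G\<^esub> k" and j = "\<lambda>h. inv\<^bsub>G\<^esub> h \<otimes>\<^bsub>G\<^esub> x"])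
      fix h assume h: "h \<in> carrier G"
      have "?z (inv\<^bsub>G\<^esub> (inv\<^bsub>G\<^esub> h \<otimes>\<^bsub>G\<^esub> x) \<otimes>\<^bsub>G\<^esub> x) = ?z (inv\<^bsub>G\<^esub> x \<otimes>\<^bsub>G\<^esub> h \<otimes>\<^bsub>G\<^esub> inv\<^bsub>G\<^esub> (inv\<^bsub>G\<^esub> x))"
        using h True by (simp add: inv_mult_group)
      also have "\<dots> = ?z h" using inv[OF h, of "inv\<^bsub>G\<^esub> x"] True by simp
      finally show "\<psi> (inv\<^bsub>G\<^esub> h \<otimes>\<^bsub>G\<^esub> x) * ?z (inv\<^bsub>G\<^esub> (inv\<^bsub>G\<^esub> h \<otimes>\<^bsub>G\<^esub> x) \<otimes>\<^bsub>G\<^esub> x) =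
        ?z h * \<psi> (inv\<^bsub>G\<^esub> h \<otimes>\<^bsub>G\<^esub> x)" by simp
    next
      fix h assume h: "h \<in> carrier G"
      show "x \<otimes>\<^bsub>G\<^esub> inv\<^bsub>G\<^esub> (inv\<^bsub>G\<^esub> h \<otimes>\<^bsub>G\<^esub> x) = h"
        using h True m_assoc[of x "inv\<^bsub>G\<^esub> x" h] by (simp add: inv_mult_group)
    next
      fix k assume k: "k \<in> carrier G"
      show "inv\<^bsub>G\<^esub> (x \<otimes>\<^bsub>G\<^esub> inv\<^bsub>G\<^esub> k) \<otimes>\<^bsub>G\<^esub> x = k"
        using k True by (simp add: inv_mult_group m_assoc)
    qed (use True in auto)
    then show ?thesis using True by (simp add: conv_def)
  qed (simp add: conv_def)
  then show ?thesis using inA by (auto simp: center_algebra_def)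
qed

lemma space_dm:
  assumes "group G" "finite (carrier G)"
  shows "space (dm G) = center_algebra G"
proof -
  have "z \<in> lin_comb G ` (\<Pi>\<^sub>E \<mu>\<in>conj_classes G. UNIV)" if "z \<in> center_algebra G" for z
  proof (rule image_eqI)
    show "z = lin_comb G (restrict (\<lambda>\<mu>. coord \<mu> z) (conj_classes G))"
      using lin_comb_coord[OF assms that] by (simp add: lin_comb_def)
  qed simp
  then show ?thesis
    using lin_comb_in_center[OF assms] by (auto simp: dm_def space_embed_measure space_PiM)
qed

lemma inj_on_lin_comb:
  assumes "group G" "finite (carrier G)"
  shows "inj_on (lin_comb G) (space (\<Pi>\<^sub>M \<mu>\<in>conj_classes G. lborel))"
proof (rule inj_onI)
  fix c d assume cd: "c \<in> space (\<Pi>\<^sub>M \<mu>\<in>conj_classes G. lborel)"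
    "d \<in> space (\<Pi>\<^sub>M \<mu>\<in>conj_classes G. lborel)" and eq: "lin_comb G c = lin_comb G d"
  have "c \<mu> = d \<mu>" if "\<mu> \<in> conj_classes G" for \<mu>
    using coord_lin_comb[OF assms that] eq by metis
  then show "c = d" using cd by (intro extensionalityI[of _ "conj_classes G"])
    (auto simp: space_PiM PiE_def)
qed

lemma tr_class_fun:
  assumes "group G" "finite (carrier G)" "\<mu> \<in> conj_classes G"
  shows "tr G (class_fun \<mu>) = (if \<mu> = {\<one>\<^bsub>G\<^esub>} then 1 else 0)"
proof -
  have one: "{\<one>\<^bsub>G\<^esub>} \<in> conj_classes G" by (rule conj_classes_facts(4)[OF assms(1)])
  have "\<one>\<^bsub>G\<^esub> \<in> \<mu> \<longleftrightarrow> \<mu> = {\<one>\<^bsub>G\<^esub>}"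
    using conj_classes_facts(2)[OF assms(1,3) one, of "\<one>\<^bsub>G\<^esub>"] by blast
  then have "coord {\<one>\<^bsub>G\<^esub>} (class_fun \<mu>) = (if \<mu> = {\<one>\<^bsub>G\<^esub>} then 1 else 0)"
    by (simp add: coord_def indicator_def)
  moreover have "tr G (class_fun \<mu>) =
      (\<Sum>\<nu>\<in>conj_classes G. if \<nu> = {\<one>\<^bsub>G\<^esub>} then coord {\<one>\<^bsub>G\<^esub>} (class_fun \<mu>) else 0)"
    unfolding tr_def by (intro sum.cong) auto
  ultimately show ?thesis
    using one conj_classes_facts(5)[OF assms(1,2)] by (simp only: sum.delta if_True)
qed


section \<open>Groups given by a presentation\<close>

text \<open>The letter \<open>(x, True)\<close> stands for the generator \<open>x\<close> and \<open>(x, False)\<close> for its inverse.\<close>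

type_synonym 'g word = "('g \<times> bool) list"

inductive word_eq :: "'g set \<Rightarrow> 'g word set \<Rightarrow> 'g word \<Rightarrow> 'g word \<Rightarrow> bool"
  for S :: "'g set" and R :: "'g word set" where
  refl: "word_eq S R w w"
| sym: "word_eq S R u w \<Longrightarrow> word_eq S R w u"
| trans: "word_eq S R u v \<Longrightarrow> word_eq S R v w \<Longrightarrow> word_eq S R u w"
| cancel: "x \<in> S \<Longrightarrow> word_eq S R (u @ [(x, b), (x, \<not> b)] @ v) (u @ v)"
| relator: "r \<in> R \<Longrightarrow> word_eq S R (u @ r @ v) (u @ v)"

definition word_class :: "'g set \<Rightarrow> 'g word set \<Rightarrow> 'g word \<Rightarrow> 'g word set" where
  "word_class S R w = {v. word_eq S R w v}"

definition presented_group :: "'g set \<Rightarrow> 'g word set \<Rightarrow> 'g word set monoid" where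
  "presented_group S R =
     \<lparr> carrier = word_class S R ` lists (S \<times> UNIV),
       mult = (\<lambda>A B. \<Union>u\<in>A. \<Union>v\<in>B. word_class S R (u @ v)),
       one = word_class S R [] \<rparr>"


lemma word_eq_append:
  assumes "word_eq S R u u'" "word_eq S R v v'"
  shows "word_eq S R (u @ v) (u' @ v')"
proof -
  have left: "word_eq S R (a @ w) (a @ w')" if "word_eq S R w w'" for a w w'
    using that
  proof induction
    case (cancel x u b v)
    show ?case using word_eq.cancel[OF cancel, of R "a @ u" b v] by simp
  next
    case (relator r u v)
    show ?case using word_eq.relator[OF relator, of S "a @ u" v] by simp
  qed (rule word_eq.refl, erule word_eq.sym, erule (1) word_eq.trans)
  have right: "word_eq S R (w @ a) (w' @ a)" if "word_eq S R w w'" for a w w'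
    using that
  proof induction
    case (cancel x u b v)
    show ?case using word_eq.cancel[OF cancel, of R u b "v @ a"] by simp
  next
    case (relator r u v)
    show ?case using word_eq.relator[OF relator, of S u "v @ a"] by simp
  qed (rule word_eq.refl, erule word_eq.sym, erule (1) word_eq.trans)
  show ?thesis using left[OF assms(2)] right[OF assms(1)] word_eq.trans by blast
qed

lemma word_class_eq_iff: "word_class S R u = word_class S R v \<longleftrightarrow> word_eq S R u v"
proof
  assume "word_class S R u = word_class S R v"
  then have "v \<in> word_class S R u" by (simp add: word_class_def word_eq.refl)
  then show "word_eq S R u v" by (simp add: word_class_def)
next
  assume uv: "word_eq S R u v"
  show "word_class S R u = word_class S R v"
    unfolding word_class_def
    using word_eq.trans[OF uv] word_eq.trans[OF word_eq.sym[OF uv]] by blast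
qed

lemma mult_presented_group:
  "word_class S R u \<otimes>\<^bsub>presented_group S R\<^esub> word_class S R v = word_class S R (u @ v)"
proof -
  have "word_class S R (u' @ v') = word_class S R (u @ v)"
    if "u' \<in> word_class S R u" "v' \<in> word_class S R v" for u' v'
    using that unfolding word_class_eq_iff
    by (intro word_eq.sym[OF word_eq_append]) (simp_all add: word_class_def)
  moreover have "w \<in> word_class S R w" for w by (simp add: word_class_def word_eq.refl)
  ultimately have "(\<Union>u'\<in>word_class S R u. \<Union>v'\<in>word_class S R v. word_class S R (u' @ v')) =
      word_class S R (u @ v)" by blast
  then show ?thesis by (simp add: presented_group_def)
qed

lemma presented_group_simps:
  shows carrier_presented_group:
      "carrier (presented_group S R) = word_class S R ` lists (S \<times> UNIV)"
    and one_presented_group: "\<one>\<^bsub>presented_group S R\<^esub> = word_class S R []"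
  by (simp_all add: presented_group_def)

lemma group_presented_group: "group (presented_group S R)"
proof (rule groupI)
  fix A assume "A \<in> carrier (presented_group S R)"
  then obtain w where w: "w \<in> lists (S \<times> UNIV)" "A = word_class S R w"
    by (auto simp: carrier_presented_group)
  define w' where "w' = rev (map (\<lambda>(x, b). (x, \<not> b)) w)"
  have "word_eq S R (rev (map (\<lambda>(x, b). (x, \<not> b)) w) @ w) []" using w(1)
  proof (induction w)
    case (Cons p w)
    obtain x b where p: "p = (x, b)" by force
    let ?v = "rev (map (\<lambda>(x, b). (x, \<not> b)) w)"
    have "word_eq S R (?v @ [(x, \<not> b), (x, \<not> \<not> b)] @ w) (?v @ w)"
      using Cons p by (intro word_eq.cancel) auto
    then show ?case using Cons.IH p by (simp add: word_eq.trans[of S R _ "?v @ w"])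
  qed (simp add: word_eq.refl)
  then have "word_class S R w' \<otimes>\<^bsub>presented_group S R\<^esub> A = \<one>\<^bsub>presented_group S R\<^esub>"
    by (simp add: w(2) mult_presented_group w'_def one_presented_group word_class_eq_iff)
  moreover have "w' \<in> lists (S \<times> UNIV)"
    using w(1) by (auto simp: w'_def in_lists_conv_set)
  then have "word_class S R w' \<in> carrier (presented_group S R)"
    by (simp add: carrier_presented_group)
  ultimately show "\<exists>B\<in>carrier (presented_group S R).
      B \<otimes>\<^bsub>presented_group S R\<^esub> A = \<one>\<^bsub>presented_group S R\<^esub>" by blast
next
  fix A B assume "A \<in> carrier (presented_group S R)" "B \<in> carrier (presented_group S R)"
  then obtain u v where "u \<in> lists (S \<times> UNIV)" "A = word_class S R u"
    "v \<in> lists (S \<times> UNIV)" "B = word_class S R v"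
    by (auto simp: carrier_presented_group)
  then show "A \<otimes>\<^bsub>presented_group S R\<^esub> B \<in> carrier (presented_group S R)"
    by (simp only: mult_presented_group carrier_presented_group imageI append_in_lists_conv)
qed (auto simp: presented_group_simps mult_presented_group)


section \<open>The Hurwitz numbers\<close>

text \<open>
  The fundamental group of the sphere punctured at \<open>n \<ge> 2\<close> points \<open>q\<^sub>0, \<dots>, q\<^sub>n\<^sub>-\<^sub>1\<close>, in its
  standard presentation.  The generators \<open>c\<^sub>0, \<dots>, c\<^sub>n\<^sub>-\<^sub>1\<close> are complete revolutions around the
  points. We place \<open>q\<^sub>0\<close> at infinity and let all of them turn counterclockwise in the affine
  chart, so \<open>c\<^sub>0\<close> is a large circle enclosing the remaining points and the only relation is
  \<open>c\<^sub>0 = c\<^sub>1 \<cdots> c\<^sub>n\<^sub>-\<^sub>1\<close>.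

  The orientation of \<open>c\<^sub>0\<close> matters. If \<open>c\<^sub>0\<close>, like the other loops, turned positively with
  respect to the complex structure of the sphere, the relation would be
  \<open>c\<^sub>0 c\<^sub>1 \<cdots> c\<^sub>n\<^sub>-\<^sub>1 = 1\<close>, and prescribing \<open>\<mu>\<close> at \<open>q\<^sub>0\<close> would amount to prescribing \<open>\<mu>\<^sup>-\<^sup>1\<close> here.
  The matrix integral forces the present choice: at \<open>\<beta> = 0\<close> it vanishes unless \<open>\<mu> = \<nu>\<close>,
  whereas with the other orientation the number for \<open>r = 0\<close> vanishes unless \<open>\<mu>\<^sup>-\<^sup>1 = \<nu>\<close>.
\<close>

definition sphere_relator :: "nat \<Rightarrow> nat word" where
  "sphere_relator n = (0, False) # map (\<lambda>i. (i, True)) [1..<n]"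

definition sphere_group :: "nat \<Rightarrow> nat word set monoid" where
  "sphere_group n = presented_group {..<n} {sphere_relator n}"

definition revolution :: "nat \<Rightarrow> nat \<Rightarrow> nat word set" where
  "revolution n i = word_class {..<n} {sphere_relator n} [(i, True)]"

text \<open>Homomorphisms are made extensional because \<open>hom\<close> leaves the values outside the carrier
  arbitrary, whereas here they are counted.\<close>

definition monodromy_homs ::
  "('a, 'b) monoid_scheme \<Rightarrow> nat \<Rightarrow> (nat \<Rightarrow> 'a set) \<Rightarrow> (nat word set \<Rightarrow> 'a) set" where
  "monodromy_homs G n C =
     {\<phi> \<in> hom (sphere_group n) G \<inter> extensional (carrier (sphere_group n)).
        \<forall>i<n. \<phi> (revolution n i) \<in> C i}"

definition hurwitz ::
  "('a, 'b) monoid_scheme \<Rightarrow> 'a set \<Rightarrow> 'a set \<Rightarrow> 'a set \<Rightarrow> nat \<Rightarrow> complex" where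
  "hurwitz G \<tau> \<mu> \<nu> r =
     of_nat (card (monodromy_homs G (r + 2)
       (\<lambda>i. if i = 0 then \<mu> else if i = r + 1 then \<nu> else \<tau>))) / of_nat (order G)"

end

theory Submission
  imports Defs "HOL-Probability.Distributions"
begin

text \<open>
  Integrating the derivative of \<open>cnj z\<^sub>\<nu> exp (- \<langle>A z, z\<rangle>)\<close> with respect to \<open>cnj z\<^sub>\<mu>\<close> shows that the
  matrix \<open>E\<^sub>\<mu>\<^sub>\<nu> = \<integral>z\<^sub>\<mu> cnj z\<^sub>\<nu> exp (- \<langle>A z, z\<rangle>)\<close> satisfies \<open>A E = Z\<close>, with \<open>Z\<close> the integral of the
  Gaussian weight, also when \<open>A\<close> is not Hermitian; neither diagonalization nor
  the determinant of \<open>A\<close> is needed. For \<open>A = A\<^sub>\<tau>(\<beta>)\<close> this says that the central element \<open>e\<close> with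
  coordinates \<open>E\<^sub>\<mu>\<^sub>\<nu> / Z\<close> solves \<open>e = f\<^sub>\<nu> / |\<nu>| + \<beta> f\<^sub>\<tau> e\<close>, whence \<open>|\<nu>| e = \<Sum>\<^sub>r \<beta>\<^sup>r f\<^sub>\<tau>\<^sup>r f\<^sub>\<nu>\<close> for small
  \<open>\<beta>\<close>. The value of \<open>f\<^sub>\<tau>\<^sup>r f\<^sub>\<nu>\<close> at \<open>a\<close> is the number of factorizations of \<open>a\<close> into \<open>r\<close> elements of
  \<open>\<tau>\<close> and one of \<open>\<nu>\<close>, and \<open>Z \<noteq> 0\<close> near \<open>\<beta> = 0\<close> by continuity, the integrand at \<open>\<beta> = 0\<close> being
  positive.
\<close>

section \<open>Complex Gaussian integrals\<close>

lemma distr_PiM_lborel_translate: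
  fixes c :: "'b::euclidean_space"
  assumes "finite I" "k \<in> I"
  shows "distr (\<Pi>\<^sub>M i\<in>I. lborel) (\<Pi>\<^sub>M i\<in>I. lborel) (\<lambda>z. z(k := z k + c)) = (\<Pi>\<^sub>M i\<in>I. lborel)"
    (is "distr ?M ?M ?f = ?M")
proof -
  interpret product_sigma_finite "\<lambda>_::'a. lborel :: 'b measure"
    by (simp add: product_sigma_finite_def lborel.sigma_finite_measure_axioms)
  have f: "?f \<in> measurable ?M ?M"
    using assms(2) by (intro measurable_fun_upd[where J = "I"]) auto
  show ?thesis
  proof (rule PiM_eqI[OF assms(1)])
    fix A :: "'a \<Rightarrow> 'b set" assume A: "\<And>i. i \<in> I \<Longrightarrow> A i \<in> sets lborel"
    \<comment> \<open>The pullback of a box is the box with its \<open>k\<close>-th side translated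
      by \<open>- c\<close>, which has the same Lebesgue measure; boxes determine the product
      measure.\<close>
    let ?B = "\<lambda>i. if i = k then (+) c -` A k else A i"
    have B: "?B i \<in> sets lborel" if "i \<in> I" for i
      using A[OF that] measurable_sets[of "(+) c" borel borel "A k"] that by auto
    have eq: "?f -` Pi\<^sub>E I A \<inter> space ?M = Pi\<^sub>E I ?B"
      using assms(2) by (auto simp: PiE_iff space_PiM extensional_def add.commute split: if_splits)
    have "emeasure lborel ((+) c -` A k) = emeasure (distr lborel borel ((+) c)) (A k)"
      using A[OF assms(2)] by (subst emeasure_distr) auto
    then have "emeasure lborel (?B i) = emeasure lborel (A i)" for i
      by (simp add: lborel_distr_plus)
    then show "emeasure (distr ?M ?M ?f) (Pi\<^sub>E I A) = (\<Prod>i\<in>I. emeasure lborel (A i))"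
      using A B assms(1) f
      by (subst emeasure_distr) (auto simp: eq emeasure_PiM intro!: sets_PiM_I_finite)
  qed simp
qed

lemma
  fixes h :: "'a \<Rightarrow> 'b::{banach, second_countable_topology}"
  assumes f: "f \<in> measurable M M" "distr M M f = M"
  shows integral_measure_preserving:
      "h \<in> borel_measurable M \<Longrightarrow> (LINT x|M. h (f x)) = (LINT x|M. h x)"
    and integrable_measure_preserving: "integrable M h \<Longrightarrow> integrable M (\<lambda>x. h (f x))"
  using integral_distr[OF f(1), of h] integrable_distr[OF f(1), of h] f(2) by simp_all

text \<open>Differentiation under the integral sign is avoided: \<open>g\<close> is integrated along the flow
  over \<open>[0, 1]\<close>, and Fubini together with invariance gives \<open>\<integral>g = \<integral>F \<circ> \<phi>\<^sub>1 - \<integral>F = 0\<close>.\<close>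

lemma integral_derivative_along_flow_eq_0:
  fixes F g :: "'a \<Rightarrow> 'b::euclidean_space"
  assumes "sigma_finite_measure M"
    and flow: "case_prod \<phi> \<in> measurable (borel \<Otimes>\<^sub>M M) M"
    and inv: "\<And>t. distr M M (\<phi> t) = M"
    and F: "integrable M F" and g: "integrable M g"
    and deriv: "\<And>x t. x \<in> space M \<Longrightarrow>
      ((\<lambda>t. F (\<phi> t x)) has_vector_derivative g (\<phi> t x)) (at t)"
    and cont: "\<And>x. x \<in> space M \<Longrightarrow> continuous_on UNIV (\<lambda>t. g (\<phi> t x))"
    and zero: "\<And>x. x \<in> space M \<Longrightarrow> \<phi> 0 x = x"
  shows "(LINT x|M. g x) = 0"
proof -
  interpret M: sigma_finite_measure M by fact
  interpret P: pair_sigma_finite lborel M ..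
  note [measurable] = borel_measurable_integrable[OF F] borel_measurable_integrable[OF g]
  have flow'[measurable]: "case_prod \<phi> \<in> measurable (lborel \<Otimes>\<^sub>M M) M"
    using flow by (simp cong: measurable_cong_sets sets_pair_measure_cong)
  have \<phi>_meas[measurable]: "\<phi> t \<in> measurable M M" for t
    using measurable_compose[OF measurable_Pair1' flow, of t] by simp
  note int_eq = integral_measure_preserving[OF \<phi>_meas inv]
  note int = integrable_measure_preserving[OF \<phi>_meas inv]
  let ?h = "\<lambda>t x. indicator {0..1::real} t *\<^sub>R g (\<phi> t x)"
  have "integrable (lborel \<Otimes>\<^sub>M M) (case_prod ?h)"
  proof (rule P.Fubini_integrable)
    \<comment> \<open>By invariance the inner integral depends on \<open>t\<close> only through the
      indicator of \<open>{0..1}\<close>, so integrability on the product reduces to that of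
      \<open>g\<close>.\<close>
    have *: "(LINT x|M. norm (case_prod ?h (t, x))) = indicator {0..1} t *\<^sub>R (LINT x|M. norm (g x))" for t
      using int_eq[of "\<lambda>x. norm (g x)" t] by simp
    show "integrable lborel (\<lambda>t. LINT x|M. norm (case_prod ?h (t, x)))"
      unfolding * by simp
    show "AE t in lborel. integrable M (\<lambda>x. case_prod ?h (t, x))"
      using int[OF g] by simp
  qed measurable
  then have "(LINT x|M. LINT t|lborel. ?h t x) = (LINT t|lborel. LINT x|M. ?h t x)"
    by (rule P.Fubini_integral)
  also have "\<dots> = (LINT t|lborel. indicator {0..1::real} t *\<^sub>R (LINT x|M. g x))"
    by (simp only: integral_scaleR_right int_eq[OF borel_measurable_integrable[OF g]])
  also have "\<dots> = (LINT x|M. g x)"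
    using integral_scaleR_left[of "LINT x|M. g x" lborel "indicat_real {0..1}"] by simp
  also have "(LINT x|M. LINT t|lborel. ?h t x) = (LINT x|M. F (\<phi> 1 x) - F x)"
  proof (rule Bochner_Integration.integral_cong[OF HOL.refl])
    fix x assume x: "x \<in> space M"
    show "(LINT t|lborel. ?h t x) = F (\<phi> 1 x) - F x"
      using integral_FTC_atLeastAtMost[of 0 1 "\<lambda>t. F (\<phi> t x)" "\<lambda>t. g (\<phi> t x)"]
        deriv[OF x] continuous_on_subset[OF cont[OF x]] zero[OF x]
      by (simp add: has_vector_derivative_at_within)
  qed
  also have "\<dots> = 0"
    using int[OF F, of 1] F int_eq[of F 1] by simp
  finally show ?thesis by simp
qed

section \<open>Integrability of real Gaussians\<close>

lemma integrable_exp_neg_mult_square: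
  fixes c :: real
  assumes "c > 0"
  shows "integrable lborel (\<lambda>x. exp (- (c * x\<^sup>2)))"
proof -
  \<comment> \<open>With variance \<open>1 / (2 * c)\<close> the normal density is a constant
    multiple of the integrand.\<close>
  define \<sigma> where "\<sigma> = 1 / sqrt (2 * c)"
  have \<sigma>: "\<sigma> > 0" "2 * \<sigma>\<^sup>2 = 1 / c" using assms by (auto simp: \<sigma>_def power_divide)
  have "integrable lborel (\<lambda>x. sqrt (2 * pi * \<sigma>\<^sup>2) * normal_density 0 \<sigma> x)"
    using \<sigma>(1) by simp
  moreover have "sqrt (2 * pi * \<sigma>\<^sup>2) * normal_density 0 \<sigma> x = exp (- (c * x\<^sup>2))" for x
    using \<sigma> assms by (simp add: normal_density_def field_simps)
  ultimately show ?thesis by simp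
qed

text \<open>The squared norm is a sum over an orthonormal basis, so the exponential factors into
  one-dimensional Gaussians and Tonelli applies.\<close>

lemma integrable_exp_neg_mult_norm_square:
  fixes c :: real
  assumes "c > 0"
  shows "integrable lborel (\<lambda>x::'a::euclidean_space. exp (- (c * (norm x)\<^sup>2)))"
proof (rule integrableI_nonneg)
  have prod: "exp (- (c * (norm x)\<^sup>2)) = (\<Prod>b\<in>Basis. exp (- (c * (x \<bullet> b)\<^sup>2)))" for x :: 'a
    by (simp add: exp_sum[symmetric] sum_negf sum_distrib_left[symmetric] power2_norm_eq_inner
        euclidean_inner[of x x] power2_eq_square[of "x \<bullet> _"])
  have "(\<integral>\<^sup>+x. ennreal (exp (- (c * (norm (x::'a))\<^sup>2))) \<partial>lborel) =
      (\<integral>\<^sup>+x. (\<Prod>b\<in>Basis. ennreal (exp (- (c * ((x::'a) \<bullet> b)\<^sup>2)))) \<partial>lborel)"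
    by (simp add: prod prod_ennreal)
  also have "\<dots> = (\<Prod>b\<in>(Basis::'a set). \<integral>\<^sup>+x. ennreal (exp (- (c * x\<^sup>2))) \<partial>lborel)"
    by (rule nn_integral_lborel_prod) auto
  also have "\<dots> < \<infinity>"
    using nn_integral_eq_integral[OF integrable_exp_neg_mult_square[OF assms]]
    by (simp add: ennreal_power[symmetric] power_less_top_ennreal)
  finally show "(\<integral>\<^sup>+x. ennreal (exp (- (c * (norm (x::'a))\<^sup>2))) \<partial>lborel) < \<infinity>" .
qed auto

section \<open>Gaussian weights of coercive forms and their moments\<close>

definition hermitian_sum :: "'i set \<Rightarrow> ('i \<Rightarrow> 'i \<Rightarrow> complex) \<Rightarrow> ('i \<Rightarrow> complex) \<Rightarrow> complex" where
  "hermitian_sum I a z = (\<Sum>i\<in>I. \<Sum>j\<in>I. a i j * z j * cnj (z i))"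

definition gaussian_weight :: "'i set \<Rightarrow> ('i \<Rightarrow> 'i \<Rightarrow> complex) \<Rightarrow> ('i \<Rightarrow> complex) \<Rightarrow> complex" where
  "gaussian_weight I a z = exp (- hermitian_sum I a z)"

text \<open>\<open>hermitian_sum I a z\<close> is \<open>\<langle>a z, z\<rangle>\<close>,
  complex-valued because \<open>a\<close> is an arbitrary matrix. A lower bound on its real part
  already dominates the modulus of the weight by a real Gaussian, and integrability only concerns
  this modulus.\<close>

locale coercive_form =
  fixes I :: "'i set" and a :: "'i \<Rightarrow> 'i \<Rightarrow> complex" and c :: real
  assumes finite_I: "finite I" and c_pos: "c > 0"
    and coercive: "\<And>z. c * (\<Sum>i\<in>I. (norm (z i))\<^sup>2) \<le> Re (hermitian_sum I a z)"
begin

abbreviation M :: "('i \<Rightarrow> complex) measure" where "M \<equiv> \<Pi>\<^sub>M i\<in>I. lborel"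

abbreviation weight :: "('i \<Rightarrow> complex) \<Rightarrow> complex" where "weight \<equiv> gaussian_weight I a"

sublocale product_sigma_finite "\<lambda>_::'i. lborel :: complex measure"
  by (simp add: product_sigma_finite_def lborel.sigma_finite_measure_axioms)

lemma component_measurable[measurable]: "i \<in> I \<Longrightarrow> (\<lambda>z. z i) \<in> borel_measurable M"
  using measurable_component_singleton[of i I "\<lambda>_. lborel"] by simp

lemma cnj_measurable[measurable]: "cnj \<in> borel_measurable borel"
  by (intro borel_measurable_continuous_onI continuous_intros)

lemma weight_measurable[measurable]: "weight \<in> borel_measurable M"
  unfolding gaussian_weight_def[abs_def] hermitian_sum_def by measurable

lemma integrable_exp_neg_sum_square:
  assumes "b > 0"
  shows "integrable M (\<lambda>z. exp (- (b * (\<Sum>i\<in>I. (norm (z i))\<^sup>2))))"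
proof -
  have "integrable M (\<lambda>z. \<Prod>i\<in>I. exp (- (b * (norm (z i))\<^sup>2)))"
    by (intro product_integrable_prod finite_I integrable_exp_neg_mult_norm_square assms)
  then show ?thesis
    by (simp add: exp_sum[OF finite_I, symmetric] sum_negf sum_distrib_left)
qed

lemma norm_weight_le: "norm (weight z) \<le> exp (- (c * (\<Sum>i\<in>I. (norm (z i))\<^sup>2)))"
  using coercive[of z] by (simp add: gaussian_weight_def)

text \<open>Half of the Gaussian decay absorbs the quadratic growth of \<open>m\<close>; the other
  half remains as an integrable bound.\<close>

lemma integrable_quadratic_mult_weight:
  assumes [measurable]: "m \<in> borel_measurable M"
    and m: "\<And>z. norm (m z) \<le> 1 + (\<Sum>i\<in>I. (norm (z i))\<^sup>2)"
  shows "integrable M (\<lambda>z. m z * weight z)"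
proof (rule Bochner_Integration.integrable_bound)
  show "integrable M (\<lambda>z. (1 + 2 / c) * exp (- (c / 2 * (\<Sum>i\<in>I. (norm (z i))\<^sup>2))))"
    using c_pos by (intro integrable_mult_right integrable_exp_neg_sum_square) simp
  have "norm (m z * weight z) \<le> (1 + 2 / c) * exp (- (c / 2 * (\<Sum>i\<in>I. (norm (z i))\<^sup>2)))" for z
  proof -
    define S where "S = (\<Sum>i\<in>I. (norm (z i))\<^sup>2)"
    have S: "S \<ge> 0" by (simp add: S_def sum_nonneg)
    \<comment> \<open>Expanding \<open>(1 + 2 / c) * (1 + c / 2 * S)\<close> gives
      \<open>1 + S\<close> plus nonnegative terms; this is where the constant
      \<open>1 + 2 / c\<close> comes from.\<close>
    have "1 + S \<le> (1 + 2 / c) * exp (c / 2 * S)"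
    proof -
      have "1 + S \<le> (1 + 2 / c) * (1 + c / 2 * S)"
        using S c_pos by (simp add: field_simps)
      also have "\<dots> \<le> (1 + 2 / c) * exp (c / 2 * S)"
        using c_pos by (intro mult_left_mono exp_ge_add_one_self) auto
      finally show ?thesis .
    qed
    moreover have "norm (m z * weight z) \<le> (1 + S) * exp (- (c * S))"
      using m[of z] norm_weight_le[of z] S by (auto simp: norm_mult S_def intro!: mult_mono)
    ultimately have "norm (m z * weight z) \<le> ((1 + 2 / c) * exp (c / 2 * S)) * exp (- (c * S))"
      by (meson exp_ge_zero mult_right_mono order_trans)
    also have "\<dots> = (1 + 2 / c) * exp (- (c / 2 * S))"
      by (simp add: mult.assoc exp_add[symmetric])
    finally show ?thesis by (simp add: S_def)
  qed
  then show "AE z in M. norm (m z * weight z) \<le>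
      norm ((1 + 2 / c) * exp (- (c / 2 * (\<Sum>i\<in>I. (norm (z i))\<^sup>2))))"
    using c_pos by (intro AE_I2) (simp add: abs_mult)
qed measurable

lemma integrable_weight: "integrable M weight"
  using integrable_quadratic_mult_weight[of "\<lambda>_. 1"] by (simp add: sum_nonneg)

lemma norm_mult_le_sum_square:
  fixes z :: "'i \<Rightarrow> complex"
  assumes "i \<in> I" "j \<in> I"
  shows "norm (z i) * norm (z j) \<le> 1 + (\<Sum>i\<in>I. (norm (z i))\<^sup>2)"
proof -
  have le: "(norm (z k))\<^sup>2 \<le> (\<Sum>i\<in>I. (norm (z i))\<^sup>2)" if "k \<in> I" for k
    using finite_I that by (intro member_le_sum) auto
  have "2 * (norm (z i) * norm (z j)) \<le> (norm (z i))\<^sup>2 + (norm (z j))\<^sup>2"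
    using sum_squares_bound[of "norm (z i)" "norm (z j)"] by (simp add: mult_ac)
  then show ?thesis using le[OF assms(1)] le[OF assms(2)] by simp
qed

lemma integrable_moments:
  assumes "i \<in> I" "j \<in> I"
  shows "integrable M (\<lambda>z. z i * cnj (z j) * weight z)"
    and "integrable M (\<lambda>z. cnj (z i) * cnj (z j) * weight z)"
  using assms norm_mult_le_sum_square[OF assms]
  by (auto intro!: integrable_quadratic_mult_weight simp: norm_mult)

lemma integrable_cnj_mult_weight:
  assumes "i \<in> I"
  shows "integrable M (\<lambda>z. cnj (z i) * weight z)"
proof (rule integrable_quadratic_mult_weight)
  fix z :: "'i \<Rightarrow> complex"
  have "(norm (z i))\<^sup>2 \<le> (\<Sum>i\<in>I. (norm (z i))\<^sup>2)"
    using finite_I assms by (intro member_le_sum) auto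
  moreover have "norm (z i) \<le> 1 + (norm (z i))\<^sup>2"
    using sum_squares_bound[of 1 "norm (z i)"] norm_ge_zero[of "z i"] by (simp del: norm_ge_zero)
  ultimately show "norm (cnj (z i)) \<le> 1 + (\<Sum>i\<in>I. (norm (z i))\<^sup>2)" by simp
qed (use assms in measurable)

text \<open>The integrand is the derivative of \<open>cnj (z l) * weight z\<close> when coordinate
  \<open>k\<close> moves with velocity \<open>s\<close>, a motion that preserves Lebesgue measure.
  Only real directional derivatives occur; varying the complex number \<open>s\<close> recovers the
  Wirtinger derivatives.\<close>

lemma integral_directional_derivative:
  fixes s :: complex
  assumes k: "k \<in> I" and l: "l \<in> I"
  defines "\<delta> \<equiv> \<lambda>i. if i = k then s else 0"
  shows "(LINT z|M. (cnj (\<delta> l) - cnj (z l) *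
      (\<Sum>i\<in>I. \<Sum>j\<in>I. a i j * (\<delta> j * cnj (z i) + z j * cnj (\<delta> i)))) * weight z) = 0"
    (is "(LINT z|M. ?g z) = 0")
proof (rule integral_derivative_along_flow_eq_0
    [where \<phi> = "\<lambda>t z. z(k := z k + t *\<^sub>R s)" and F = "\<lambda>z. cnj (z l) * weight z"])
  show "sigma_finite_measure M" by (rule sigma_finite[OF finite_I])
  show "case_prod (\<lambda>t z. z(k := z k + t *\<^sub>R s)) \<in> measurable (borel \<Otimes>\<^sub>M M) M"
    unfolding case_prod_beta
    using k by (intro measurable_fun_upd[where J = I]) (auto simp: measurable_lborel1)
  show "distr M M (\<lambda>z. z(k := z k + t *\<^sub>R s)) = M" for t
    by (rule distr_PiM_lborel_translate[OF finite_I k])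
  show "integrable M (\<lambda>z. cnj (z l) * weight z)"
    using l by (rule integrable_cnj_mult_weight)
  \<comment> \<open>Expansion exhibits \<open>?g\<close> as a combination of the weight and its
    second moments, all of them integrable.\<close>
  have "?g = (\<lambda>z. cnj (\<delta> l) * weight z -
      (\<Sum>i\<in>I. \<Sum>j\<in>I. a i j * \<delta> j * (cnj (z i) * cnj (z l) * weight z) +
         a i j * cnj (\<delta> i) * (z j * cnj (z l) * weight z)))"
    by (simp add: algebra_simps sum_distrib_left sum_distrib_right)
  then show "integrable M ?g"
    by (simp only:) (intro Bochner_Integration.integrable_diff Bochner_Integration.integrable_sum
        Bochner_Integration.integrable_add integrable_mult_right integrable_weight
        integrable_moments l)
  \<comment> \<open>Moved and fixed coordinates get one common expression affine in
    \<open>t\<close>, so the derivative rules apply to the whole double sum without case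
    distinctions.\<close>
  have upd: "(z(k := z k + t *\<^sub>R s)) i = z i + of_real t * \<delta> i" for z i t
    by (simp add: \<delta>_def scaleR_conv_of_real)
  show "((\<lambda>t. cnj ((z(k := z k + t *\<^sub>R s)) l) * weight (z(k := z k + t *\<^sub>R s)))
      has_vector_derivative ?g (z(k := z k + t *\<^sub>R s))) (at t)" for z t
    unfolding upd gaussian_weight_def hermitian_sum_def
  proof -
    let ?u = "\<lambda>t i. z i + of_real t * \<delta> i"
    have u: "((\<lambda>t. ?u t i) has_vector_derivative \<delta> i) (at t)" for i
      unfolding has_vector_derivative_def
      by (auto intro!: derivative_eq_intros simp: scaleR_conv_of_real)
    have "((\<lambda>t. - (\<Sum>i\<in>I. \<Sum>j\<in>I. a i j * ?u t j * cnj (?u t i))) has_vector_derivative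
        - (\<Sum>i\<in>I. \<Sum>j\<in>I. a i j * ?u t j * cnj (\<delta> i) + a i j * \<delta> j * cnj (?u t i))) (at t)"
      by (intro has_vector_derivative_minus has_vector_derivative_sum has_vector_derivative_mult
          has_vector_derivative_mult_right has_vector_derivative_cnj u)
    from has_vector_derivative_mult[OF has_vector_derivative_cnj[OF u[of l]]
        field_vector_diff_chain_at[OF this DERIV_exp]]
    show "((\<lambda>t. cnj (?u t l) * exp (- (\<Sum>i\<in>I. \<Sum>j\<in>I. a i j * ?u t j * cnj (?u t i))))
      has_vector_derivative (cnj (\<delta> l) - cnj (?u t l) *
      (\<Sum>i\<in>I. \<Sum>j\<in>I. a i j * (\<delta> j * cnj (?u t i) + ?u t j * cnj (\<delta> i)))) *
      exp (- (\<Sum>i\<in>I. \<Sum>j\<in>I. a i j * ?u t j * cnj (?u t i)))) (at t)"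
      unfolding comp_def
      by (rule has_vector_derivative_eq_rhs) (simp add: algebra_simps sum.distrib)
  qed
  show "continuous_on UNIV (\<lambda>t. ?g (z(k := z k + t *\<^sub>R s)))" for z
    unfolding upd gaussian_weight_def hermitian_sum_def by (intro continuous_intros)
qed simp

text \<open>The vanishing integral splits into a part linear in \<open>s\<close>, with coefficient
  \<open>P\<close>, and a conjugate-linear part, with coefficient \<open>D\<close> times the
  integral of the weight minus \<open>Q\<close>. Each part must vanish separately, and the second is
  row \<open>k\<close> of the system for the moments.\<close>

lemma second_moments:
  assumes k: "k \<in> I" and l: "l \<in> I"
  shows "(\<Sum>j\<in>I. a k j * (LINT z|M. z j * cnj (z l) * weight z)) =
    (if k = l then LINT z|M. weight z else 0)"
proof -
  define D :: complex where "D = (if l = k then 1 else 0)"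
  define P where "P = (\<Sum>i\<in>I. a i k * (LINT z|M. cnj (z i) * cnj (z l) * weight z))"
  define Q where "Q = (\<Sum>j\<in>I. a k j * (LINT z|M. z j * cnj (z l) * weight z))"
  have eq: "cnj s * D * (LINT z|M. weight z) - s * P - cnj s * Q = 0" for s
  proof -
    have "(cnj (if l = k then s else 0) - cnj (z l) * (\<Sum>i\<in>I. \<Sum>j\<in>I. a i j *
          ((if j = k then s else 0) * cnj (z i) + z j * cnj (if i = k then s else 0)))) * weight z =
        cnj s * D * weight z - s * (\<Sum>i\<in>I. a i k * (cnj (z i) * cnj (z l) * weight z)) -
        cnj s * (\<Sum>j\<in>I. a k j * (z j * cnj (z l) * weight z))" for z
    proof -
      have "(\<Sum>i\<in>I. \<Sum>j\<in>I. a i j *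
          ((if j = k then s else 0) * cnj (z i) + z j * cnj (if i = k then s else 0))) =
          (\<Sum>i\<in>I. \<Sum>j\<in>I. if j = k then a i k * s * cnj (z i) else 0) +
          (\<Sum>i\<in>I. if i = k then (\<Sum>j\<in>I. a k j * z j * cnj s) else 0)"
        unfolding sum.distrib[symmetric]
        by (intro sum.cong HOL.refl) (auto simp: algebra_simps sum.distrib[symmetric] intro!: sum.cong)
      also have "\<dots> = (\<Sum>i\<in>I. a i k * s * cnj (z i)) + (\<Sum>j\<in>I. a k j * z j * cnj s)"
        using finite_I k by simp
      finally show ?thesis
        by (simp add: D_def algebra_simps sum_distrib_left sum_distrib_right)
    qed
    then show ?thesis
      using integral_directional_derivative[OF k l, of s] l
      by (simp add: P_def Q_def integrable_weight integrable_moments)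
  qed
  \<comment> \<open>The choice \<open>s = 1\<close> makes the difference of the two sides equal to
    \<open>P\<close>, the choice \<open>s = \<i>\<close> makes it equal to
    \<open>- P\<close>.\<close>
  have "D * (LINT z|M. weight z) = Q"
    using eq[of 1] eq[of \<i>] by (simp add: complex_eq_iff)
  then show ?thesis by (auto simp: D_def Q_def split: if_splits)
qed

text \<open>A real form has a positive weight, and a positive function with integral 0 would make
  the whole space a null set.\<close>

lemma integral_weight_neq_0:
  assumes real: "\<And>z. hermitian_sum I a z \<in> \<real>"
  shows "(LINT z|M. weight z) \<noteq> 0"
proof
  assume 0: "(LINT z|M. weight z) = 0"
  have eq: "weight z = of_real (Re (weight z))" "Re (weight z) > 0" for z
  proof -
    obtain x where "hermitian_sum I a z = of_real x" using real[of z] by (auto elim: Reals_cases)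
    then have "weight z = of_real (exp (- x))"
      by (simp add: gaussian_weight_def exp_of_real[symmetric])
    then show "weight z = of_real (Re (weight z))" "Re (weight z) > 0" by simp_all
  qed
  have int: "integrable M (\<lambda>z. Re (weight z))" using integrable_weight by simp
  have "(LINT z|M. Re (weight z)) = 0"
    using 0 integral_Re[OF integrable_weight] by simp
  then have "AE z in M. Re (weight z) = 0"
    using eq(2) by (subst (asm) integral_nonneg_eq_0_iff_AE[OF int]) (auto intro: less_imp_le)
  then have "AE z in M. False"
    using eq(2) by (auto elim!: eventually_mono simp: less_le)
  then have "emeasure M (space M) = 0"
    by (simp add: eventually_False ae_filter_eq_bot_iff)
  \<comment> \<open>The total mass is infinite, or 1 as an empty product if \<open>I\<close> is
    empty; it is never 0.\<close>
  moreover have "emeasure M (space M) = (\<Prod>i\<in>I. \<infinity>)"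
    using emeasure_PiM[OF finite_I, of "\<lambda>_. UNIV"] by (simp add: space_PiM)
  ultimately show False by (cases "card I") (simp_all add: ennreal_mult_eq_top_iff)
qed

end

text \<open>The diagonal contributes at least the square sum \<open>S\<close>. As
  \<open>norm (z i) * norm (z j)\<close> is at most the mean of the two squares, the perturbation
  has modulus at most \<open>norm \<beta> * B * card I * S\<close>, hence at most half of
  \<open>S\<close>.\<close>

lemma coercive_form_near_diagonal:
  fixes d :: "'i \<Rightarrow> real" and t :: "'i \<Rightarrow> 'i \<Rightarrow> complex"
  assumes "finite I" and d: "\<And>i. i \<in> I \<Longrightarrow> d i \<ge> 1"
    and t: "\<And>i j. i \<in> I \<Longrightarrow> j \<in> I \<Longrightarrow> norm (t i j) \<le> B"
    and \<beta>: "norm \<beta> * B * card I \<le> 1 / 2"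
  shows "coercive_form I (\<lambda>i j. (if i = j then of_real (d i) else 0) - \<beta> * t i j) (1 / 2)"
proof
  fix z :: "'i \<Rightarrow> complex"
  define S where "S = (\<Sum>i\<in>I. (norm (z i))\<^sup>2)"
  have S: "S \<ge> 0" by (simp add: S_def sum_nonneg)
  have eq: "hermitian_sum I (\<lambda>i j. (if i = j then of_real (d i) else 0) - \<beta> * t i j) z =
      of_real (\<Sum>i\<in>I. d i * (norm (z i))\<^sup>2) - \<beta> * hermitian_sum I t z"
  proof -
    have "(\<Sum>j\<in>I. ((if i = j then of_real (d i) else 0) - \<beta> * t i j) * z j * cnj (z i)) =
       of_real (d i * (norm (z i))\<^sup>2) - \<beta> * (\<Sum>j\<in>I. t i j * z j * cnj (z i))" if "i \<in> I" for i
    proof -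
      have "(\<Sum>j\<in>I. ((if i = j then of_real (d i) else 0) - \<beta> * t i j) * z j * cnj (z i)) =
        (\<Sum>j\<in>I. if i = j then of_real (d i) * (z i * cnj (z i)) else 0) -
        (\<Sum>j\<in>I. \<beta> * (t i j * z j * cnj (z i)))"
        unfolding sum_subtractf[symmetric] by (intro sum.cong) (auto simp: algebra_simps)
      then show ?thesis
        using assms(1) that
        by (simp add: sum_distrib_left complex_norm_square[symmetric] del: of_real_power)
    qed
    then show ?thesis
      by (simp add: hermitian_sum_def sum_subtractf sum_distrib_left)
  qed
  have "norm (hermitian_sum I t z) \<le> (\<Sum>i\<in>I. \<Sum>j\<in>I. B * (((norm (z i))\<^sup>2 + (norm (z j))\<^sup>2) / 2))"
    unfolding hermitian_sum_def
  proof (intro order_trans[OF norm_sum] sum_mono)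
    fix i j assume ij: "i \<in> I" "j \<in> I"
    have "norm (t i j * z j * cnj (z i)) = norm (t i j) * (norm (z i) * norm (z j))"
      by (simp add: norm_mult)
    also have "\<dots> \<le> B * (((norm (z i))\<^sup>2 + (norm (z j))\<^sup>2) / 2)"
      using t[OF ij] sum_squares_bound[of "norm (z i)" "norm (z j)"] order_trans[OF norm_ge_zero t[OF ij]]
      by (intro mult_mono) auto
    finally show "norm (t i j * z j * cnj (z i)) \<le> B * (((norm (z i))\<^sup>2 + (norm (z j))\<^sup>2) / 2)" .
  qed
  also have "\<dots> = B * card I * S"
    by (simp add: S_def sum_distrib_left[symmetric] sum.distrib sum_divide_distrib[symmetric] field_simps)
  finally have "norm (\<beta> * hermitian_sum I t z) \<le> norm \<beta> * (B * card I * S)"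
    by (simp add: norm_mult mult_left_mono)
  also have "\<dots> \<le> 1 / 2 * S"
    using mult_right_mono[OF \<beta> S] by (simp add: mult_ac)
  finally have "Re (\<beta> * hermitian_sum I t z) \<le> 1 / 2 * S"
    using complex_Re_le_cmod order_trans by blast
  moreover have "S \<le> (\<Sum>i\<in>I. d i * (norm (z i))\<^sup>2)"
    unfolding S_def using d by (intro sum_mono) (simp add: mult_le_cancel_right1)
  ultimately show "1 / 2 * (\<Sum>i\<in>I. (norm (z i))\<^sup>2) \<le>
      Re (hermitian_sum I (\<lambda>i j. (if i = j then of_real (d i) else 0) - \<beta> * t i j) z)"
    unfolding eq by (simp add: S_def)
qed (use assms in auto)

text \<open>The coercivity constant is uniform on a ball, so one real Gaussian dominates all weights
  there. By dominated convergence the integral is continuous at 0, where the form is real and the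
  integral does not vanish.\<close>

lemma eventually_coercive_and_integral_neq_0:
  fixes d :: "'i \<Rightarrow> real" and t :: "'i \<Rightarrow> 'i \<Rightarrow> complex"
  assumes I: "finite I" and d: "\<And>i. i \<in> I \<Longrightarrow> d i \<ge> 1"
  defines "a \<equiv> \<lambda>\<beta> i j. (if i = j then of_real (d i) else 0) - \<beta> * t i j"
  shows "\<forall>\<^sub>F \<beta> in nhds 0. coercive_form I (a \<beta>) (1 / 2) \<and>
    (LINT z|(\<Pi>\<^sub>M i\<in>I. lborel). gaussian_weight I (a \<beta>) z) \<noteq> 0"
proof -
  define B where "B = (\<Sum>i\<in>I. \<Sum>j\<in>I. norm (t i j))"
  have B: "norm (t i j) \<le> B" if "i \<in> I" "j \<in> I" for i j
  proof -
    have "norm (t i j) \<le> (\<Sum>j\<in>I. norm (t i j))"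
      using I that by (intro member_le_sum) auto
    also have "\<dots> \<le> B"
      unfolding B_def using I that
      by (intro member_le_sum[of i I "\<lambda>i. \<Sum>j\<in>I. norm (t i j)"]) (auto intro: sum_nonneg)
    finally show ?thesis .
  qed
  \<comment> \<open>The summand 1 keeps \<open>N\<close> positive even if all \<open>t i j\<close>
    vanish or \<open>I\<close> is empty; the radius \<open>1 / (2 * N)\<close> gives
    \<open>norm \<beta> * N \<le> 1 / 2\<close>.\<close>
  define N where "N = B * card I + 1"
  define \<epsilon> where "\<epsilon> = 1 / (2 * N)"
  have N: "N > 0" by (simp add: N_def B_def sum_nonneg add_nonneg_pos)
  then have \<epsilon>: "\<epsilon> > 0" by (simp add: \<epsilon>_def)
  have coercive: "coercive_form I (a \<beta>) (1 / 2)" if "\<beta> \<in> ball 0 \<epsilon>" for \<beta>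
    unfolding a_def
  proof (rule coercive_form_near_diagonal[OF I d B])
    have "norm \<beta> * N \<le> 1 / 2"
      using that N by (simp add: \<epsilon>_def field_simps)
    then show "norm \<beta> * B * card I \<le> 1 / 2"
      using norm_ge_zero[of \<beta>] by (simp add: N_def algebra_simps del: norm_ge_zero)
  qed
  let ?M = "\<Pi>\<^sub>M i\<in>I. lborel :: complex measure"
  let ?Z = "\<lambda>\<beta>. LINT z|?M. gaussian_weight I (a \<beta>) z"
  interpret C0: coercive_form I "a 0" "1 / 2" using coercive \<epsilon> by simp
  have "hermitian_sum I (a 0) z \<in> \<real>" for z
  proof -
    have "a 0 i j * z j * cnj (z i) \<in> \<real>" for i j
      by (auto simp: a_def mult.assoc complex_norm_square[symmetric] simp del: of_real_power)
    then show ?thesis unfolding hermitian_sum_def by (intro sum_in_Reals) auto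
  qed
  then have Z0: "?Z 0 \<noteq> 0" by (rule C0.integral_weight_neq_0)
  \<comment> \<open>Restricting to the ball keeps every sequence where the uniform bound holds; the
    ball is open, so this does not affect the limit.\<close>
  have "(?Z \<longlongrightarrow> ?Z 0) (at 0 within ball 0 \<epsilon>)"
    unfolding tendsto_at_iff_sequentially comp_def
  proof (intro allI impI)
    fix X :: "nat \<Rightarrow> complex" assume X: "\<forall>n. X n \<in> ball 0 \<epsilon> - {0}" "X \<longlonglongrightarrow> 0"
    have cX: "coercive_form I (a (X n)) (1 / 2)" for n using X(1) by (intro coercive) auto
    show "(\<lambda>n. ?Z (X n)) \<longlonglongrightarrow> ?Z 0"
    proof (rule integral_dominated_convergence)
      show "integrable ?M (\<lambda>z. exp (- (1 / 2 * (\<Sum>i\<in>I. (norm (z i))\<^sup>2))))"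
        by (rule C0.integrable_exp_neg_sum_square) simp
      show "AE z in ?M. (\<lambda>n. gaussian_weight I (a (X n)) z) \<longlonglongrightarrow> gaussian_weight I (a 0) z"
        unfolding gaussian_weight_def hermitian_sum_def a_def
        by (intro AE_I2 tendsto_intros X(2))
      show "AE z in ?M. norm (gaussian_weight I (a (X n)) z) \<le>
          exp (- (1 / 2 * (\<Sum>i\<in>I. (norm (z i))\<^sup>2)))" for n
        using coercive_form.norm_weight_le[OF cX[of n]] by (intro AE_I2)
      show "gaussian_weight I (a (X n)) \<in> borel_measurable ?M" for n
        by (rule coercive_form.weight_measurable[OF cX])
    qed measurable
  qed
  then have "(?Z \<longlongrightarrow> ?Z 0) (at 0)"
    using \<epsilon> by (simp add: at_within_open[of 0 "ball 0 \<epsilon>"])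
  then have "\<forall>\<^sub>F \<beta> in at 0. ?Z \<beta> \<noteq> 0"
    using Z0 by (rule tendsto_imp_eventually_ne)
  then have "\<forall>\<^sub>F \<beta> in nhds 0. ?Z \<beta> \<noteq> 0"
    unfolding eventually_at_filter using Z0 by (auto elim!: eventually_mono)
  moreover have "\<forall>\<^sub>F \<beta> in nhds 0. coercive_form I (a \<beta>) (1 / 2)"
    using coercive \<epsilon> unfolding eventually_nhds_metric by (auto simp: dist_commute intro!: exI[of _ \<epsilon>])
  ultimately show ?thesis by eventually_elim simp
qed

section \<open>Multiplication in the center of the group algebra\<close>

locale finite_group = group G for G (structure) +
  assumes finite_carrier: "finite (carrier G)"
begin

lemmas conj_classes_finite = conj_classes_facts(5)[OF group_axioms finite_carrier]

lemma conj_class_subset: "\<mu> \<in> conj_classes G \<Longrightarrow> \<mu> \<subseteq> carrier G"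
  using conj_classes_facts(1)[OF group_axioms] by blast

lemma conj_class_finite: "\<mu> \<in> conj_classes G \<Longrightarrow> finite \<mu>"
  using conj_class_subset finite_carrier finite_subset by blast

lemma conj_class_card_pos: "\<mu> \<in> conj_classes G \<Longrightarrow> card \<mu> > 0"
  using conj_classes_facts(3)[OF group_axioms] conj_class_finite by (simp add: card_gt_0_iff)

lemma lin_comb_mem: "lin_comb G c \<in> center_algebra G"
  by (rule lin_comb_in_center[OF group_axioms finite_carrier])

lemma class_fun_eq_lin_comb:
  "\<mu> \<in> conj_classes G \<Longrightarrow> class_fun \<mu> = lin_comb G (\<lambda>\<nu>. if \<nu> = \<mu> then 1 else 0)"
  using conj_classes_finite by (simp add: lin_comb_def fun_eq_iff if_distrib[of "\<lambda>c. c * _"] cong: if_cong)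

lemma class_fun_mem: "\<mu> \<in> conj_classes G \<Longrightarrow> class_fun \<mu> \<in> center_algebra G"
  by (simp add: class_fun_eq_lin_comb lin_comb_mem)

lemma center_algebraD: "z \<in> center_algebra G \<Longrightarrow> a \<notin> carrier G \<Longrightarrow> z a = 0"
  by (simp add: center_algebra_def group_algebra_def)

lemma sum_center_algebra:
  assumes "z \<in> center_algebra G" "\<mu> \<in> conj_classes G" "a \<in> \<mu>"
  shows "(\<Sum>b\<in>\<mu>. z b) = of_nat (card \<mu>) * z a"
proof -
  have "z b = coord \<mu> z" if "b \<in> \<mu>" for b
    using lin_comb_eval[OF group_axioms finite_carrier assms(2) that]
      lin_comb_coord[OF group_axioms finite_carrier assms(1)] by metis
  then show ?thesis using assms(3) by simp
qed

section \<open>Convolution on the center\<close>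

lemma conv_mem: "conv G u v \<in> group_algebra G"
  by (simp add: conv_def group_algebra_def)

lemma conv_assoc: "conv G (conv G u v) w = conv G u (conv G v w)"
proof
  fix x
  show "conv G (conv G u v) w x = conv G u (conv G v w) x"
  proof (cases "x \<in> carrier G")
    case True
    have "(\<Sum>h\<in>carrier G. (\<Sum>k\<in>carrier G. u k * v (inv k \<otimes> h)) * w (inv h \<otimes> x)) =
        (\<Sum>k\<in>carrier G. u k * (\<Sum>h\<in>carrier G. v (inv k \<otimes> h) * w (inv h \<otimes> x)))"
      unfolding sum_distrib_left sum_distrib_right by (subst sum.swap) (simp add: mult.assoc)
    also have "\<dots> = (\<Sum>k\<in>carrier G. u k * (\<Sum>h\<in>carrier G. v h * w (inv h \<otimes> (inv k \<otimes> x))))"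
    proof (rule sum.cong[OF HOL.refl])
      fix k assume k: "k \<in> carrier G"
      have "(\<Sum>h\<in>carrier G. v (inv k \<otimes> h) * w (inv h \<otimes> x)) =
          (\<Sum>h\<in>carrier G. v h * w (inv h \<otimes> (inv k \<otimes> x)))"
      proof -
        have "k \<otimes> (inv k \<otimes> y) = y" "inv k \<otimes> (k \<otimes> y) = y" if "y \<in> carrier G" for y
          using k that by (simp_all add: m_assoc[symmetric])
        then show ?thesis
          using k True
          by (intro sum.reindex_bij_witness[where i = "\<lambda>h. k \<otimes> h" and j = "\<lambda>h. inv k \<otimes> h"])
            (auto simp: m_assoc inv_mult_group)
      qed
      then show "u k * (\<Sum>h\<in>carrier G. v (inv k \<otimes> h) * w (inv h \<otimes> x)) =
          u k * (\<Sum>h\<in>carrier G. v h * w (inv h \<otimes> (inv k \<otimes> x)))" by simp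
    qed
    finally show ?thesis using True by (simp add: conv_def cong: sum.cong)
  qed (simp add: conv_def)
qed

lemma conv_center_algebra:
  assumes "z \<in> center_algebra G" "w \<in> center_algebra G"
  shows "conv G z w \<in> center_algebra G"
proof -
  have "conv G (conv G z w) u = conv G u (conv G z w)" if u: "u \<in> group_algebra G" for u
  proof -
    have "conv G (conv G z w) u = conv G z (conv G u w)"
      using assms(2) u by (simp add: conv_assoc center_algebra_def)
    also have "\<dots> = conv G u (conv G z w)"
      using assms(1) u by (simp add: conv_assoc[symmetric] center_algebra_def)
    finally show ?thesis .
  qed
  then show ?thesis by (simp add: center_algebra_def conv_mem)
qed

lemma conv_commute: "z \<in> center_algebra G \<Longrightarrow> w \<in> center_algebra G \<Longrightarrow> conv G z w = conv G w z"
  unfolding center_algebra_def by blast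

lemma conv_class_fun:
  assumes "\<tau> \<in> conj_classes G" "a \<in> carrier G"
  shows "conv G (class_fun \<tau>) w a = (\<Sum>h\<in>\<tau>. w (inv h \<otimes> a))"
proof -
  have "conv G (class_fun \<tau>) w a = (\<Sum>h\<in>carrier G \<inter> \<tau>. w (inv h \<otimes> a))"
    using assms(2) finite_carrier by (simp add: conv_def sum.inter_restrict indicator_def if_distrib
        cong: if_cong)
  then show ?thesis using conj_class_subset[OF assms(1)] by (simp add: Int_absorb1)
qed

lemma conv_linear_right:
  "conv G u (\<lambda>g. x * v g + y * w g) = (\<lambda>a. x * conv G u v a + y * conv G u w a)"
  by (rule ext)
    (simp add: conv_def distrib_left sum.distrib sum_distrib_left mult.left_commute)

lemma conv_one_right:
  assumes "a \<in> carrier G"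
  shows "conv G u (class_fun {\<one>}) a = u a"
proof -
  have "u h * class_fun {\<one>} (inv h \<otimes> a) = (if h = a then u h else 0)" if "h \<in> carrier G" for h
  proof -
    have "inv h \<otimes> a = \<one> \<longleftrightarrow> h = a"
      using assms that inv_solve_left'[of \<one> h a] by auto
    then show ?thesis by (simp add: indicator_def)
  qed
  then have "(\<Sum>h\<in>carrier G. u h * class_fun {\<one>} (inv h \<otimes> a)) =
      (\<Sum>h\<in>carrier G. if h = a then u h else 0)"
    by (rule sum.cong[OF HOL.refl])
  also have "\<dots> = u a"
    using assms finite_carrier by simp
  finally show ?thesis
    unfolding conv_def if_P[OF assms] .
qed

section \<open>The trace and the matrix \<open>A_matrix\<close>\<close>

lemma tr_eq: "tr G z = z \<one>"
proof -
  have "tr G z = (\<Sum>\<mu>\<in>conj_classes G. if \<mu> = {\<one>} then coord \<mu> z else 0)"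
    unfolding tr_def by (intro sum.cong) auto
  then show ?thesis
    using conj_classes_finite conj_classes_facts(4)[OF group_axioms] by (simp add: coord_def)
qed

text \<open>At the unit, convolution pairs each \<open>h\<close> with \<open>inv h\<close>, so the
  inverse class turns the trace into a sum over the class itself. The matrix entries and the
  prefactors of the integral are both evaluated in this way.\<close>

lemma tr_conv_inv_class:
  assumes "\<mu> \<in> conj_classes G"
  shows "tr G (conv G (class_fun (inv_class G \<mu>)) v) = (\<Sum>a\<in>\<mu>. v a)"
proof -
  have "(\<Sum>h\<in>carrier G. class_fun (inv_class G \<mu>) h * v (inv h \<otimes> \<one>)) =
      (\<Sum>h\<in>carrier G. class_fun \<mu> h * v h)"
  proof (rule sum.reindex_bij_witness[where i = "m_inv G" and j = "m_inv G"])
    fix h assume h: "h \<in> carrier G"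
    have "inv h \<in> \<mu> \<longleftrightarrow> h \<in> inv_class G \<mu>"
      using h conj_class_subset[OF assms] unfolding inv_class_def by (force simp: image_iff)
    then show "class_fun \<mu> (inv h) * v (inv h) = class_fun (inv_class G \<mu>) h * v (inv h \<otimes> \<one>)"
      using h by (simp add: indicator_def)
  qed auto
  also have "\<dots> = (\<Sum>h\<in>carrier G \<inter> \<mu>. v h)"
    using finite_carrier by (simp add: sum.inter_restrict indicator_def if_distrib cong: if_cong)
  finally show ?thesis
    using conj_class_subset[OF assms] by (simp add: tr_eq conv_def Int_absorb1)
qed

lemma sum_class_fun:
  assumes "\<mu> \<in> conj_classes G" "\<nu> \<in> conj_classes G"
  shows "(\<Sum>a\<in>\<mu>. class_fun \<nu> a) = (if \<mu> = \<nu> then of_nat (card \<mu>) else 0)"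
proof (cases "\<mu> = \<nu>")
  case False
  then have "class_fun \<nu> a = 0" if "a \<in> \<mu>" for a
    using that conj_classes_facts(2)[OF group_axioms assms] by (auto simp: indicator_def)
  then show ?thesis using False by simp
qed simp

text \<open>This is the shape required for coercivity near \<open>\<beta> = 0\<close>: a diagonal of
  class sizes, hence at least 1, minus \<open>\<beta>\<close> times a fixed matrix.\<close>

lemma A_matrix_eq:
  assumes "\<mu> \<in> conj_classes G" "\<nu> \<in> conj_classes G" "\<tau> \<in> conj_classes G"
  shows "A_matrix G \<tau> \<beta> \<mu> \<nu> = (if \<mu> = \<nu> then of_real (real (card \<mu>)) else 0) -
    \<beta> * (\<Sum>a\<in>\<mu>. conv G (class_fun \<tau>) (class_fun \<nu>) a)"
proof -
  have "conv G (class_fun \<nu>) (\<lambda>g. class_fun {\<one>} g - \<beta> * class_fun \<tau> g) a =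
      class_fun \<nu> a - \<beta> * conv G (class_fun \<tau>) (class_fun \<nu>) a" if "a \<in> carrier G" for a
    using conv_linear_right[of "class_fun \<nu>" 1 "class_fun {\<one>}" "- \<beta>" "class_fun \<tau>"]
      conv_one_right[OF that] conv_commute[OF class_fun_mem[OF assms(3)] class_fun_mem[OF assms(2)]]
    by simp
  then have "A_matrix G \<tau> \<beta> \<mu> \<nu> =
      (\<Sum>a\<in>\<mu>. class_fun \<nu> a - \<beta> * conv G (class_fun \<tau>) (class_fun \<nu>) a)"
    unfolding A_matrix_def conv_assoc tr_conv_inv_class[OF assms(1)]
    using conj_class_subset[OF assms(1)] by (intro sum.cong) auto
  then show ?thesis
    by (simp add: sum_subtractf sum_class_fun assms sum_distrib_left[symmetric])
qed

lemma conv_lin_comb: "conv G u (lin_comb G c) = (\<lambda>a. \<Sum>\<mu>\<in>conj_classes G. c \<mu> * conv G u (class_fun \<mu>) a)"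
proof
  fix a
  have "(\<Sum>h\<in>carrier G. u h * (\<Sum>\<mu>\<in>conj_classes G. c \<mu> * class_fun \<mu> (inv h \<otimes> a))) =
      (\<Sum>\<mu>\<in>conj_classes G. c \<mu> * (\<Sum>h\<in>carrier G. u h * class_fun \<mu> (inv h \<otimes> a)))"
    unfolding sum_distrib_left by (subst sum.swap) (simp only: mult.left_commute)
  then show "conv G u (lin_comb G c) a = (\<Sum>\<mu>\<in>conj_classes G. c \<mu> * conv G u (class_fun \<mu>) a)"
    by (simp only: conv_def lin_comb_def) simp
qed

text \<open>With \<open>e = lin_comb G c\<close>, the linear system \<open>A c = \<delta>\<^sub>\<nu>\<close> says that \<open>(1 - \<beta> f\<^sub>\<tau>) e\<close> is
  \<open>f\<^sub>\<nu> / |\<nu>|\<close>, because an element of the center with vanishing class sums is zero.\<close>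

lemma lin_comb_fixpoint:
  assumes \<nu>: "\<nu> \<in> conj_classes G" and \<tau>: "\<tau> \<in> conj_classes G"
    and c: "\<And>\<mu>. \<mu> \<in> conj_classes G \<Longrightarrow>
      (\<Sum>\<kappa>\<in>conj_classes G. A_matrix G \<tau> \<beta> \<mu> \<kappa> * c \<kappa>) = (if \<mu> = \<nu> then 1 else 0)"
  shows "lin_comb G c =
    (\<lambda>a. (1 / of_nat (card \<nu>)) * class_fun \<nu> a + \<beta> * conv G (class_fun \<tau>) (lin_comb G c) a)"
proof
  fix a
  let ?e = "lin_comb G c"
  show "?e a = (1 / of_nat (card \<nu>)) * class_fun \<nu> a + \<beta> * conv G (class_fun \<tau>) ?e a"
  proof (cases "a \<in> carrier G")
    case True
    then obtain \<mu> where \<mu>: "\<mu> \<in> conj_classes G" "a \<in> \<mu>"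
      using conj_classes_facts(1)[OF group_axioms] by blast
    have "(\<Sum>\<kappa>\<in>conj_classes G. A_matrix G \<tau> \<beta> \<mu> \<kappa> * c \<kappa>) =
        (\<Sum>\<kappa>\<in>conj_classes G. if \<mu> = \<kappa> then of_nat (card \<mu>) * c \<mu> else 0) -
        (\<Sum>\<kappa>\<in>conj_classes G. \<beta> * (\<Sum>b\<in>\<mu>. c \<kappa> * conv G (class_fun \<tau>) (class_fun \<kappa>) b))"
      unfolding sum_subtractf[symmetric]
      by (intro sum.cong) (auto simp: A_matrix_eq[OF \<mu>(1) _ \<tau>] algebra_simps sum_distrib_left)
    also have "\<dots> = of_nat (card \<mu>) * c \<mu> - \<beta> * (\<Sum>b\<in>\<mu>. conv G (class_fun \<tau>) ?e b)"
    proof -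
      have "(\<Sum>\<kappa>\<in>conj_classes G. \<beta> * (\<Sum>b\<in>\<mu>. c \<kappa> * conv G (class_fun \<tau>) (class_fun \<kappa>) b)) =
          \<beta> * (\<Sum>b\<in>\<mu>. \<Sum>\<kappa>\<in>conj_classes G. c \<kappa> * conv G (class_fun \<tau>) (class_fun \<kappa>) b)"
        unfolding sum_distrib_left[of \<beta>, symmetric] by (subst sum.swap) (rule HOL.refl)
      then show ?thesis using \<mu>(1) conj_classes_finite by (simp only: conv_lin_comb) simp
    qed
    also have "c \<mu> = ?e a"
      using lin_comb_eval[OF group_axioms finite_carrier \<mu>] by simp
    \<comment> \<open>The product of central elements is central, hence constant on
      \<open>\<mu>\<close>. All terms thus carry the factor \<open>card \<mu>\<close>, and the
      equation of class sums becomes one of values at \<open>a\<close>.\<close>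
    also have "(\<Sum>b\<in>\<mu>. conv G (class_fun \<tau>) ?e b) = of_nat (card \<mu>) * conv G (class_fun \<tau>) ?e a"
      by (intro sum_center_algebra[OF _ \<mu>] conv_center_algebra class_fun_mem \<tau> lin_comb_mem)
    finally have "of_nat (card \<mu>) * (?e a - \<beta> * conv G (class_fun \<tau>) ?e a) = (if \<mu> = \<nu> then 1 else 0)"
      using c[OF \<mu>(1)] by (simp add: algebra_simps)
    moreover have "class_fun \<nu> a = (if \<mu> = \<nu> then 1 else 0)"
      using \<mu> conj_classes_facts(2)[OF group_axioms \<mu>(1) \<nu>] by (auto simp: indicator_def)
    ultimately show ?thesis
      using conj_class_card_pos[OF \<mu>(1)] by (auto simp: field_simps split: if_splits)
  next
    case False
    then show ?thesis
      using center_algebraD[OF lin_comb_mem] conj_class_subset[OF \<nu>]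
      by (auto simp: conv_def indicator_def)
  qed
qed

section \<open>The Neumann series for convolution with a class function\<close>

lemma conv_funpow_linear:
  "(conv G u ^^ r) (\<lambda>a. x * v a + y * w a) = (\<lambda>a. x * (conv G u ^^ r) v a + y * (conv G u ^^ r) w a)"
  by (induction r) (simp_all add: conv_linear_right)

text \<open>One convolution with a function with values 0 and 1 adds up at most
  \<open>order G\<close> values. This crude geometric growth is outweighed by
  \<open>\<beta> ^ r\<close> once \<open>norm \<beta> * of_nat (order G) < 1\<close>.\<close>

lemma norm_conv_class_fun_funpow_le:
  assumes "\<And>a. norm (w a) \<le> B"
  shows "norm ((conv G (class_fun \<tau>) ^^ r) w a) \<le> of_nat (order G) ^ r * B"
proof (induction r arbitrary: a)
  case (Suc r)
  let ?v = "(conv G (class_fun \<tau>) ^^ r) w"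
  have B: "B \<ge> 0" using assms[of undefined] norm_ge_zero order_trans by blast
  have "norm (conv G (class_fun \<tau>) ?v a) \<le> (\<Sum>h\<in>carrier G. of_nat (order G) ^ r * B)"
  proof (cases "a \<in> carrier G")
    case True
    have "norm (class_fun \<tau> h * ?v (inv h \<otimes> a)) \<le> of_nat (order G) ^ r * B" for h
      using Suc.IH[of "inv h \<otimes> a"] B by (cases "h \<in> \<tau>") simp_all
    then have "norm (\<Sum>h\<in>carrier G. class_fun \<tau> h * ?v (inv h \<otimes> a)) \<le>
        (\<Sum>h\<in>carrier G. of_nat (order G) ^ r * B)"
      by (intro order_trans[OF norm_sum sum_mono])
    then show ?thesis unfolding conv_def if_P[OF True] .
  next
    case False
    then show ?thesis using B by (simp add: conv_def sum_nonneg)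
  qed
  then show ?case by (simp add: order_def)
qed (simp add: assms)

text \<open>Substituting the fixed point equation into itself \<open>n\<close> times yields the
  \<open>n\<close>-th partial sum of the Neumann series, divided by \<open>card \<nu>\<close>, and a
  remainder \<open>\<beta> ^ n\<close> times the \<open>n\<close>-th iterate of \<open>e\<close>,
  which tends to 0 because \<open>e\<close> is bounded.\<close>

lemma sums_conv_funpow:
  assumes \<nu>: "\<nu> \<in> conj_classes G"
    and e: "\<And>a. norm (e a) \<le> B"
    and eq: "e = (\<lambda>a. (1 / of_nat (card \<nu>)) * class_fun \<nu> a + \<beta> * conv G (class_fun \<tau>) e a)"
    and \<beta>: "norm \<beta> * of_nat (order G) < 1"
  shows "(\<lambda>r. (conv G (class_fun \<tau>) ^^ r) (class_fun \<nu>) a * \<beta> ^ r) sums (of_nat (card \<nu>) * e a)"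
proof -
  let ?R = "\<lambda>r. conv G (class_fun \<tau>) ^^ r"
  have step: "?R r e b = (1 / of_nat (card \<nu>)) * ?R r (class_fun \<nu>) b + \<beta> * ?R (Suc r) e b" for r b
    by (subst eq, subst conv_funpow_linear) (simp add: funpow_swap1)
  have partial: "e a = (1 / of_nat (card \<nu>)) * (\<Sum>r<n. ?R r (class_fun \<nu>) a * \<beta> ^ r) + \<beta> ^ n * ?R n e a"
    for n
  proof (induction n)
    case (Suc n)
    then show ?case by (subst (asm) step) (simp add: algebra_simps)
  qed simp
  have "(\<lambda>n. \<beta> ^ n * ?R n e a) \<longlonglongrightarrow> 0"
  proof (rule Lim_null_comparison)
    have "norm (\<beta> ^ n * ?R n e a) \<le> (norm \<beta> * of_nat (order G)) ^ n * B" for n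
      using mult_left_mono[OF norm_conv_class_fun_funpow_le[OF e], of "norm \<beta> ^ n"]
      by (simp add: norm_mult norm_power power_mult_distrib mult_ac)
    then show "\<forall>\<^sub>F n in sequentially. norm (\<beta> ^ n * ?R n e a) \<le> (norm \<beta> * of_nat (order G)) ^ n * B"
      by simp
    show "(\<lambda>n. (norm \<beta> * of_nat (order G)) ^ n * B) \<longlonglongrightarrow> 0"
      using \<beta> by (intro tendsto_mult_left_zero LIMSEQ_power_zero) simp
  qed
  then have "(\<lambda>n. of_nat (card \<nu>) * (e a - \<beta> ^ n * ?R n e a)) \<longlonglongrightarrow> of_nat (card \<nu>) * (e a - 0)"
    by (intro tendsto_intros)
  moreover have "of_nat (card \<nu>) * (e a - \<beta> ^ n * ?R n e a) = (\<Sum>r<n. ?R r (class_fun \<nu>) a * \<beta> ^ r)" for n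
    using partial[of n] conj_class_card_pos[OF \<nu>] by (simp add: field_simps)
  ultimately show ?thesis by (simp add: sums_def)
qed

end

section \<open>Homomorphisms from the sphere group\<close>

text \<open>The entry with index \<open>i\<close> is the image of the loop
  \<open>c\<^sub>i\<^sub>+\<^sub>1\<close>, so index \<open>r\<close> belongs to the last puncture.
  The loop \<open>c\<^sub>0\<close> is omitted because the relation makes it the product of the
  others.\<close>

definition monodromy_tuples :: "'a set \<Rightarrow> 'a set \<Rightarrow> nat \<Rightarrow> 'a list set" where
  "monodromy_tuples \<tau> \<nu> r = {xs. length xs = Suc r \<and> (\<forall>i\<le>r. xs ! i \<in> (if i = r then \<nu> else \<tau>))}"

context group
begin

section \<open>Evaluation of words and the universal property of a presentation\<close>

definition word_val :: "('g \<Rightarrow> 'a) \<Rightarrow> 'g word \<Rightarrow> 'a" where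
  "word_val x w = foldr (\<lambda>(i, b) g. (if b then x i else inv (x i)) \<otimes> g) w \<one>"

lemma word_val_simps[simp]:
  "word_val x [] = \<one>"
  "word_val x ((i, b) # w) = (if b then x i else inv (x i)) \<otimes> word_val x w"
  by (simp_all add: word_val_def)

lemma word_val_closed[simp]: "range x \<subseteq> carrier G \<Longrightarrow> word_val x w \<in> carrier G"
  by (induction w) (auto simp: subset_iff)

lemma word_val_append:
  "range x \<subseteq> carrier G \<Longrightarrow> word_val x (u @ v) = word_val x u \<otimes> word_val x v"
  by (induction u) (auto simp: subset_iff m_assoc)

lemma word_val_cong:
  "(\<And>i. i \<in> S \<Longrightarrow> x i = y i) \<Longrightarrow> w \<in> lists (S \<times> UNIV) \<Longrightarrow> word_val x w = word_val y w"
  by (induction w) auto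

text \<open>Cancelling pairs always evaluate to the unit and relators do by hypothesis, so
  evaluation descends to the presented group.\<close>

lemma word_val_word_eq:
  assumes x: "range x \<subseteq> carrier G" and R: "\<And>r. r \<in> R \<Longrightarrow> word_val x r = \<one>"
    and "word_eq S R u v"
  shows "word_val x u = word_val x v"
  using assms(3)
proof induction
  case (cancel i u b v)
  have "x i \<in> carrier G" using x by blast
  then show ?case using x by (cases b) (simp_all add: word_val_append m_assoc[symmetric])
qed (simp_all add: word_val_append x R)

text \<open>Uniqueness half of the universal property. Cancellation makes the class of
  \<open>(i, False)\<close> inverse to that of \<open>(i, True)\<close>, so the values on positive
  letters fix those on all words.\<close>

lemma hom_presented_group_eq_word_val:
  assumes \<phi>: "\<phi> \<in> hom (presented_group S R) G" and "w \<in> lists (S \<times> UNIV)"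
  shows "\<phi> (word_class S R w) = word_val (\<lambda>i. \<phi> (word_class S R [(i, True)])) w"
  using assms(2)
proof (induction w)
  case Nil
  interpret P: group "presented_group S R" by (rule group_presented_group)
  show ?case
    using hom_one[OF \<phi> P.group_axioms group_axioms] by (simp add: one_presented_group)
next
  case (Cons l w)
  interpret P: group "presented_group S R" by (rule group_presented_group)
  interpret h: group_hom "presented_group S R" G \<phi> by unfold_locales (rule \<phi>)
  obtain i b where l: "l = (i, b)" "i \<in> S" using Cons.hyps by (cases l) auto
  have mem: "word_class S R v \<in> carrier (presented_group S R)" if "v \<in> lists (S \<times> UNIV)" for v
    using that by (simp add: carrier_presented_group)
  have "word_class S R [(i, False)] \<otimes>\<^bsub>presented_group S R\<^esub> word_class S R [(i, True)] =
      \<one>\<^bsub>presented_group S R\<^esub>"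
    using word_eq.cancel[of i S R "[]" False "[]"] l(2)
    by (simp add: mult_presented_group one_presented_group word_class_eq_iff)
  then have "word_class S R [(i, False)] =
      inv\<^bsub>presented_group S R\<^esub> (word_class S R [(i, True)])"
    using mem l(2) by (intro P.inv_equality[symmetric]) auto
  then have letter: "\<phi> (word_class S R [l]) =
      (if b then \<phi> (word_class S R [(i, True)]) else inv (\<phi> (word_class S R [(i, True)])))"
    using mem l by (auto simp: h.hom_inv)
  have "\<phi> (word_class S R (l # w)) = \<phi> (word_class S R [l] \<otimes>\<^bsub>presented_group S R\<^esub> word_class S R w)"
    by (simp add: mult_presented_group)
  also have "\<dots> = \<phi> (word_class S R [l]) \<otimes> \<phi> (word_class S R w)"
    using Cons.hyps l mem by (intro h.hom_mult) auto
  finally show ?case using Cons.IH letter l(1) by simp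
qed

text \<open>Existence half of the universal property. Each class is evaluated at a representative
  picked by \<open>SOME\<close>; the choice does not matter by
  \<open>word_val_word_eq\<close>.\<close>

lemma exists_hom_presented_group:
  assumes x: "range x \<subseteq> carrier G" and R: "\<And>r. r \<in> R \<Longrightarrow> word_val x r = \<one>"
  obtains \<phi> where "\<phi> \<in> hom (presented_group S R) G"
    "\<phi> \<in> extensional (carrier (presented_group S R))"
    "\<And>w. w \<in> lists (S \<times> UNIV) \<Longrightarrow> \<phi> (word_class S R w) = word_val x w"
proof
  let ?\<phi> = "restrict (\<lambda>A. word_val x (SOME w. w \<in> A)) (carrier (presented_group S R))"
  have eval: "?\<phi> (word_class S R w) = word_val x w" if w: "w \<in> lists (S \<times> UNIV)" for w
  proof -
    have "w \<in> word_class S R w" by (simp add: word_class_def word_eq.refl)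
    then have "(SOME v. v \<in> word_class S R w) \<in> word_class S R w" by (rule someI)
    then have "word_val x w = word_val x (SOME v. v \<in> word_class S R w)"
      by (intro word_val_word_eq[OF x R]) (auto simp: word_class_def)
    then show ?thesis using w by (simp add: carrier_presented_group)
  qed
  then show "\<And>w. w \<in> lists (S \<times> UNIV) \<Longrightarrow> ?\<phi> (word_class S R w) = word_val x w" .
  show "?\<phi> \<in> hom (presented_group S R) G"
  proof (rule homI)
    fix A B assume "A \<in> carrier (presented_group S R)" "B \<in> carrier (presented_group S R)"
    then obtain u v where uv: "u \<in> lists (S \<times> UNIV)" "A = word_class S R u"
      "v \<in> lists (S \<times> UNIV)" "B = word_class S R v"
      by (auto simp: carrier_presented_group)
    then have "?\<phi> (word_class S R (u @ v)) = word_val x (u @ v)" by (intro eval) simp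
    then show "?\<phi> (A \<otimes>\<^bsub>presented_group S R\<^esub> B) = ?\<phi> A \<otimes> ?\<phi> B"
      by (simp only: uv eval mult_presented_group word_val_append[OF x])
  qed (simp add: x)
qed (rule restrict_extensional)

section \<open>Homomorphisms from the sphere group as tuples with prescribed product\<close>

definition lprod :: "'a list \<Rightarrow> 'a" where
  "lprod xs = foldr (\<otimes>) xs \<one>"

lemma lprod_simps[simp]: "lprod [] = \<one>" "lprod (a # xs) = a \<otimes> lprod xs"
  by (simp_all add: lprod_def)

lemma lprod_closed: "set xs \<subseteq> carrier G \<Longrightarrow> lprod xs \<in> carrier G"
  by (induction xs) auto

lemma word_val_positive: "word_val x (map (\<lambda>i. (i, True)) is) = lprod (map x is)"
  by (induction "is") auto

lemma word_val_sphere_relator: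
  assumes "range x \<subseteq> carrier G"
  shows "word_val x (sphere_relator n) = \<one> \<longleftrightarrow> x 0 = lprod (map x [1..<n])"
proof -
  have "x 0 \<in> carrier G" "lprod (map x [1..<n]) \<in> carrier G"
    using assms by (auto intro!: lprod_closed simp: image_subset_iff)
  then have "inv (x 0) \<otimes> lprod (map x [1..<n]) = \<one> \<longleftrightarrow> x 0 = lprod (map x [1..<n])"
    by (metis inv_closed inv_equality inv_inv l_inv)
  then show ?thesis by (simp add: sphere_relator_def word_val_positive)
qed

lemma monodromy_tuples_subset:
  assumes "\<nu> \<subseteq> carrier G" "\<tau> \<subseteq> carrier G" "xs \<in> monodromy_tuples \<tau> \<nu> r"
  shows "set xs \<subseteq> carrier G"
proof
  fix a assume "a \<in> set xs"
  then obtain i where "i \<le> r" "a = xs ! i"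
    using assms(3) by (auto simp: in_set_conv_nth monodromy_tuples_def less_Suc_eq_le)
  then show "a \<in> carrier G"
    using assms by (auto simp: monodromy_tuples_def split: if_splits)
qed

text \<open>A homomorphism is determined by its values on the loops other than \<open>c\<^sub>0\<close>, which can be
  prescribed freely.\<close>

lemma bij_betw_monodromy_homs:
  assumes sub: "\<mu> \<subseteq> carrier G" "\<nu> \<subseteq> carrier G" "\<tau> \<subseteq> carrier G"
  shows "bij_betw (\<lambda>\<phi>. map (\<lambda>i. \<phi> (revolution (r + 2) i)) [1..<r + 2])
    (monodromy_homs G (r + 2) (\<lambda>i. if i = 0 then \<mu> else if i = r + 1 then \<nu> else \<tau>))
    {xs \<in> monodromy_tuples \<tau> \<nu> r. lprod xs \<in> \<mu>}"
    (is "bij_betw ?f ?H ?L")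
proof -
  let ?n = "r + 2"
  let ?S = "{..<?n}" and ?R = "{sphere_relator ?n}"
  have rel: "sphere_relator ?n \<in> lists (?S \<times> UNIV)"
    by (auto simp: sphere_relator_def)
  have word: "\<phi> (word_class ?S ?R w) = word_val (\<lambda>i. \<phi> (revolution ?n i)) w"
    if "\<phi> \<in> ?H" "w \<in> lists (?S \<times> UNIV)" for \<phi> w
    using hom_presented_group_eq_word_val[of \<phi> ?S ?R w] that
    by (simp add: monodromy_homs_def sphere_group_def revolution_def)
  have vals: "\<phi> (revolution ?n i) \<in> (if i = 0 then \<mu> else if i = r + 1 then \<nu> else \<tau>)"
    if "\<phi> \<in> ?H" "i < ?n" for \<phi> i
    using that unfolding monodromy_homs_def by blast
  have first: "\<phi> (revolution ?n 0) = lprod (?f \<phi>)" if \<phi>: "\<phi> \<in> ?H" for \<phi>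
  proof -
    \<comment> \<open>Beyond the generators \<open>\<phi>\<close> need not take values in the
      carrier, so the assignment is completed by the unit; words over the generators do not see the
      difference.\<close>
    define x where "x i = (if i < ?n then \<phi> (revolution ?n i) else \<one>)" for i
    have "x i \<in> carrier G" for i
      using vals[OF \<phi>, of i] sub by (cases "i < ?n") (auto simp: x_def split: if_splits)
    then have x: "range x \<subseteq> carrier G" by blast
    have "word_eq ?S ?R (sphere_relator ?n) []"
      using word_eq.relator[of "sphere_relator ?n" ?R ?S "[]" "[]"] by simp
    then have "word_class ?S ?R (sphere_relator ?n) = word_class ?S ?R []"
      by (simp add: word_class_eq_iff)
    then have "word_val (\<lambda>i. \<phi> (revolution ?n i)) (sphere_relator ?n) = \<one>"
      using word[OF \<phi> rel] word[OF \<phi>, of "[]"] by simp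
    then have "word_val x (sphere_relator ?n) = \<one>"
      using word_val_cong[of ?S x "\<lambda>i. \<phi> (revolution ?n i)", OF _ rel] by (simp add: x_def)
    then have "x 0 = lprod (map x [1..<?n])" using word_val_sphere_relator[OF x] by simp
    moreover have "map x [1..<?n] = ?f \<phi>" by (rule map_cong) (auto simp: x_def)
    moreover have "x 0 = \<phi> (revolution ?n 0)" by (simp add: x_def)
    ultimately show ?thesis by (simp only:)
  qed
  show ?thesis
  proof (rule bij_betw_imageI)
    show "inj_on ?f ?H"
    proof (rule inj_onI)
      fix \<phi> \<psi> assume \<phi>: "\<phi> \<in> ?H" and \<psi>: "\<psi> \<in> ?H" and eq: "?f \<phi> = ?f \<psi>"
      have gen: "\<phi> (revolution ?n i) = \<psi> (revolution ?n i)" if "i < ?n" for i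
      proof (cases "i = 0")
        case True
        show ?thesis unfolding True first[OF \<phi>] first[OF \<psi>] eq ..
      next
        case False
        then have "i \<in> set [1..<?n]" using that by (simp del: upt_Suc)
        then show ?thesis using eq unfolding map_eq_conv by blast
      qed
      have "\<phi> A = \<psi> A" if "A \<in> carrier (sphere_group ?n)" for A
      proof -
        have "A \<in> word_class ?S ?R ` lists (?S \<times> UNIV)"
          using that by (simp only: sphere_group_def carrier_presented_group)
        then show ?thesis
        proof (rule imageE)
          fix w assume w: "A = word_class ?S ?R w" "w \<in> lists (?S \<times> UNIV)"
          have "word_val (\<lambda>i. \<phi> (revolution ?n i)) w = word_val (\<lambda>i. \<psi> (revolution ?n i)) w"
            by (rule word_val_cong[OF _ w(2)]) (rule gen, simp)
          then show ?thesis by (simp only: w(1) word[OF \<phi> w(2)] word[OF \<psi> w(2)])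
        qed
      qed
      then show "\<phi> = \<psi>"
        using \<phi> \<psi> by (intro extensionalityI[of _ "carrier (sphere_group ?n)"])
          (auto simp: monodromy_homs_def)
    qed
    show "?f ` ?H = ?L"
    proof (intro equalityI subsetI)
      fix xs assume "xs \<in> ?f ` ?H"
      then obtain \<phi> where \<phi>: "\<phi> \<in> ?H" "xs = ?f \<phi>" by blast
      have "xs ! i \<in> (if i = r then \<nu> else \<tau>)" if "i \<le> r" for i
        using vals[OF \<phi>(1), of "Suc i"] that \<phi>(2) by (simp del: upt_Suc)
      moreover have "lprod xs \<in> \<mu>" using first[OF \<phi>(1)] vals[OF \<phi>(1), of 0] \<phi>(2) by simp
      ultimately show "xs \<in> ?L" using \<phi>(2) by (simp add: monodromy_tuples_def del: upt_Suc)
    next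
      fix xs assume xs: "xs \<in> ?L"
      then have len: "length xs = Suc r" and nth: "\<And>i. i \<le> r \<Longrightarrow> xs ! i \<in> (if i = r then \<nu> else \<tau>)"
        by (auto simp: monodromy_tuples_def)
      \<comment> \<open>Sending \<open>c\<^sub>0\<close> to the product of the tuple is exactly what
        makes the relator trivial; list positions start at 0 and the remaining loops at 1, hence
        \<open>i - 1\<close>.\<close>
      define x where "x i = (if i = 0 then lprod xs else if i < ?n then xs ! (i - 1) else \<one>)" for i
      have set_xs: "set xs \<subseteq> carrier G" using monodromy_tuples_subset[of \<nu> \<tau> xs r] sub xs by simp
      have x: "range x \<subseteq> carrier G"
        using set_xs lprod_closed[OF set_xs] len by (auto simp: x_def subset_iff)
      have map_x: "map x [1..<?n] = xs"
        using len by (intro nth_equalityI) (simp_all add: x_def del: upt_Suc)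
      have R: "word_val x w = \<one>" if "w \<in> ?R" for w
        using that map_x word_val_sphere_relator[OF x, of ?n] by (simp add: x_def)
      obtain \<phi> where \<phi>: "\<phi> \<in> hom (presented_group ?S ?R) G"
        "\<phi> \<in> extensional (carrier (presented_group ?S ?R))"
        "\<And>w. w \<in> lists (?S \<times> UNIV) \<Longrightarrow> \<phi> (word_class ?S ?R w) = word_val x w"
        using exists_hom_presented_group[OF x R] by metis
      have gen: "\<phi> (revolution ?n i) = x i" if "i < ?n" for i
        using \<phi>(3)[of "[(i, True)]"] that x by (auto simp: revolution_def subset_iff)
      have "x i \<in> (if i = 0 then \<mu> else if i = r + 1 then \<nu> else \<tau>)" if "i < ?n" for i
        using xs nth that by (cases i) (auto simp: x_def)
      then have "\<phi> \<in> ?H" using \<phi>(1,2) gen by (simp add: monodromy_homs_def sphere_group_def)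
      moreover have "xs = ?f \<phi>"
        unfolding map_x[symmetric] map_eq_conv set_upt by (intro ballI gen[symmetric]) simp
      ultimately show "xs \<in> ?f ` ?H" by (intro image_eqI[where x = \<phi>])
    qed
  qed
qed

end

context finite_group
begin

section \<open>Counting factorizations by convolution\<close>

lemma finite_monodromy_tuples:
  assumes "\<nu> \<subseteq> carrier G" "\<tau> \<subseteq> carrier G"
  shows "finite (monodromy_tuples \<tau> \<nu> r)"
proof (rule finite_subset)
  have "set xs \<subseteq> carrier G \<and> length xs = Suc r" if "xs \<in> monodromy_tuples \<tau> \<nu> r" for xs
    using monodromy_tuples_subset[OF assms that] that by (simp add: monodromy_tuples_def)
  then show "monodromy_tuples \<tau> \<nu> r \<subseteq> {xs. set xs \<subseteq> carrier G \<and> length xs = Suc r}"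
    by blast
  show "finite {xs. set xs \<subseteq> carrier G \<and> length xs = Suc r}"
    by (rule finite_lists_length_eq[OF finite_carrier])
qed

text \<open>Induction by splitting off the first factor: if it is \<open>c\<close> in
  \<open>\<tau>\<close>, the rest is a factorization of \<open>inv c \<otimes> a\<close>. Summing
  over \<open>c\<close> is convolution with \<open>class_fun \<tau>\<close>.\<close>

lemma card_monodromy_tuples_lprod:
  assumes \<nu>: "\<nu> \<in> conj_classes G" and \<tau>: "\<tau> \<in> conj_classes G" and "a \<in> carrier G"
  shows "of_nat (card {xs \<in> monodromy_tuples \<tau> \<nu> r. lprod xs = a}) =
    (conv G (class_fun \<tau>) ^^ r) (class_fun \<nu>) a"
  using assms(3)
proof (induction r arbitrary: a)
  case 0
  have "{xs \<in> monodromy_tuples \<tau> \<nu> 0. lprod xs = a} = (if a \<in> \<nu> then {[a]} else {})"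
    using conj_class_subset[OF \<nu>] by (auto simp: monodromy_tuples_def length_Suc_conv)
  then show ?case by (simp add: indicator_def)
next
  case (Suc r)
  note sub = conj_class_subset[OF \<nu>] conj_class_subset[OF \<tau>]
  let ?C = "\<lambda>r a. {xs \<in> monodromy_tuples \<tau> \<nu> r. lprod xs = a}"
  have cons: "c # xs \<in> monodromy_tuples \<tau> \<nu> (Suc r) \<longleftrightarrow> c \<in> \<tau> \<and> xs \<in> monodromy_tuples \<tau> \<nu> r" for c xs
    by (auto simp: monodromy_tuples_def nth_Cons All_less_Suc2 less_Suc_eq_le[symmetric] split: nat.splits)
  have eq: "c \<otimes> lprod xs = a \<longleftrightarrow> lprod xs = inv c \<otimes> a" if "c \<in> \<tau>" "xs \<in> monodromy_tuples \<tau> \<nu> r" for c xs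
    using that sub Suc.prems lprod_closed[OF monodromy_tuples_subset[OF sub that(2)]]
    by (metis inv_solve_left subsetD)
  have "?C (Suc r) a = (\<Union>c\<in>\<tau>. Cons c ` ?C r (inv c \<otimes> a))"
  proof (intro equalityI subsetI)
    fix ys assume ys: "ys \<in> ?C (Suc r) a"
    then obtain c xs where "ys = c # xs" by (cases ys) (auto simp: monodromy_tuples_def)
    moreover from this have "c \<in> \<tau>" "xs \<in> ?C r (inv c \<otimes> a)" using ys cons eq by auto
    ultimately show "ys \<in> (\<Union>c\<in>\<tau>. Cons c ` ?C r (inv c \<otimes> a))" by blast
  next
    fix ys assume "ys \<in> (\<Union>c\<in>\<tau>. Cons c ` ?C r (inv c \<otimes> a))"
    then obtain c xs where "c \<in> \<tau>" "xs \<in> ?C r (inv c \<otimes> a)" "ys = c # xs" by blast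
    then show "ys \<in> ?C (Suc r) a" using cons[of c xs] eq[of c xs] by simp
  qed
  also have "card \<dots> = (\<Sum>c\<in>\<tau>. card (Cons c ` ?C r (inv c \<otimes> a)))"
    using finite_monodromy_tuples[OF sub] conj_class_finite[OF \<tau>] by (intro card_UN_disjoint) auto
  also have "\<dots> = (\<Sum>c\<in>\<tau>. card (?C r (inv c \<otimes> a)))"
    by (simp add: card_image)
  also have "of_nat \<dots> = (\<Sum>c\<in>\<tau>. (conv G (class_fun \<tau>) ^^ r) (class_fun \<nu>) (inv c \<otimes> a))"
    using sub(2) Suc.prems by (auto intro!: sum.cong Suc.IH)
  finally show ?case by (simp add: conv_class_fun[OF \<tau> Suc.prems])
qed

text \<open>The tuples are sorted by their product, which is the value of the homomorphism on
  \<open>c\<^sub>0\<close>.\<close>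

lemma hurwitz_eq:
  assumes "\<mu> \<in> conj_classes G" "\<nu> \<in> conj_classes G" "\<tau> \<in> conj_classes G"
  shows "hurwitz G \<tau> \<mu> \<nu> r =
    (\<Sum>a\<in>\<mu>. (conv G (class_fun \<tau>) ^^ r) (class_fun \<nu>) a) / of_nat (order G)"
proof -
  note sub = assms[THEN conj_class_subset]
  have "{xs \<in> monodromy_tuples \<tau> \<nu> r. lprod xs \<in> \<mu>} = (\<Union>a\<in>\<mu>. {xs \<in> monodromy_tuples \<tau> \<nu> r. lprod xs = a})"
    by auto
  also have "card \<dots> = (\<Sum>a\<in>\<mu>. card {xs \<in> monodromy_tuples \<tau> \<nu> r. lprod xs = a})"
    using finite_monodromy_tuples[OF sub(2,3)] conj_class_finite[OF assms(1)] by (intro card_UN_disjoint) auto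
  finally have "card {xs \<in> monodromy_tuples \<tau> \<nu> r. lprod xs \<in> \<mu>} =
    (\<Sum>a\<in>\<mu>. card {xs \<in> monodromy_tuples \<tau> \<nu> r. lprod xs = a})" .
  then have "of_nat (card {xs \<in> monodromy_tuples \<tau> \<nu> r. lprod xs \<in> \<mu>}) =
      (\<Sum>a\<in>\<mu>. (conv G (class_fun \<tau>) ^^ r) (class_fun \<nu>) a)"
    using sub(1) by (auto intro!: sum.cong card_monodromy_tuples_lprod assms)
  then show ?thesis
    using bij_betw_same_card[OF bij_betw_monodromy_homs[OF sub, of r]] by (simp add: hurwitz_def)
qed

end

section \<open>The matrix integral\<close>

context finite_group
begin

section \<open>Passage to coordinates and to generating functions\<close>

lemma herm_A_endo_lin_comb:
  "herm G (A_endo G \<tau> \<beta> (lin_comb G c)) (lin_comb G c) =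
    hermitian_sum (conj_classes G) (A_matrix G \<tau> \<beta>) c"
  by (simp add: herm_def A_endo_def hermitian_sum_def sum_distrib_right
      coord_lin_comb[OF group_axioms finite_carrier] cong: sum.cong)

lemma gauss_lin_comb:
  "gauss G \<tau> \<beta> (lin_comb G c) = gaussian_weight (conj_classes G) (A_matrix G \<tau> \<beta>) c"
  by (simp add: gauss_def gaussian_weight_def herm_A_endo_lin_comb)

text \<open>Since \<open>lin_comb G\<close> is injective on the coordinate space,
  \<open>dm G\<close> is its push-forward measure, and the change of variables formula
  applies.\<close>

lemma
  fixes h :: "('a \<Rightarrow> complex) \<Rightarrow> complex"
  assumes "(\<lambda>c. h (lin_comb G c)) \<in> borel_measurable (\<Pi>\<^sub>M \<mu>\<in>conj_classes G. lborel)"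
  shows integral_dm: "(LINT z|dm G. h z) = (LINT c|(\<Pi>\<^sub>M \<mu>\<in>conj_classes G. lborel). h (lin_comb G c))"
    and integrable_dm: "integrable (dm G) h \<longleftrightarrow>
      integrable (\<Pi>\<^sub>M \<mu>\<in>conj_classes G. lborel) (\<lambda>c. h (lin_comb G c))"
proof -
  let ?M = "\<Pi>\<^sub>M \<mu>\<in>conj_classes G. lborel :: complex measure"
  note inj = inj_on_lin_comb[OF group_axioms finite_carrier]
  have dm: "dm G = distr ?M (dm G) (lin_comb G)"
    unfolding dm_def by (rule embed_measure_eq_distr'[OF inj])
  have meas: "lin_comb G \<in> measurable ?M (dm G)"
    unfolding dm_def by (rule measurable_embed_measure2'[OF inj])
  have h: "h \<in> borel_measurable (dm G)"
    unfolding dm_def by (rule measurable_embed_measure1[where f = "lin_comb G" and g = h, OF assms])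
  show "(LINT z|dm G. h z) = (LINT c|?M. h (lin_comb G c))"
    by (subst dm) (rule integral_distr[OF meas h])
  show "integrable (dm G) h \<longleftrightarrow> integrable ?M (\<lambda>c. h (lin_comb G c))"
    by (subst dm) (rule integrable_distr_eq[OF meas h])
qed

text \<open>The integrals enter only through the linear system that \<open>c\<close> solves. The
  Neumann series of \<open>lin_comb G c\<close> is summed over \<open>\<mu>\<close>, where this
  central element is constantly \<open>c \<mu>\<close>; this produces the factor
  \<open>card \<mu>\<close>.\<close>

lemma sums_hurwitz:
  assumes \<mu>: "\<mu> \<in> conj_classes G" and \<nu>: "\<nu> \<in> conj_classes G" and \<tau>: "\<tau> \<in> conj_classes G"
    and c: "\<And>\<kappa>. \<kappa> \<in> conj_classes G \<Longrightarrow>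
      (\<Sum>\<rho>\<in>conj_classes G. A_matrix G \<tau> \<beta> \<kappa> \<rho> * c \<rho>) = (if \<kappa> = \<nu> then 1 else 0)"
    and \<beta>: "norm \<beta> * of_nat (order G) < 1"
  shows "(\<lambda>r. hurwitz G \<tau> \<mu> \<nu> r * \<beta> ^ r) sums
    (of_nat (card \<mu>) * of_nat (card \<nu>) / of_nat (order G) * c \<mu>)"
proof -
  let ?e = "lin_comb G c"
  let ?B = "\<Sum>a\<in>carrier G. norm (?e a)"
  have B: "norm (?e a) \<le> ?B" for a
  proof (cases "a \<in> carrier G")
    case True
    then show ?thesis using finite_carrier by (intro member_le_sum) auto
  next
    case False
    then show ?thesis using center_algebraD[OF lin_comb_mem] by (simp add: sum_nonneg)
  qed
  have "(\<lambda>r. \<Sum>a\<in>\<mu>. (conv G (class_fun \<tau>) ^^ r) (class_fun \<nu>) a * \<beta> ^ r) sums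
      (\<Sum>a\<in>\<mu>. of_nat (card \<nu>) * ?e a)"
    by (intro sums_sum sums_conv_funpow[OF \<nu> B lin_comb_fixpoint[OF \<nu> \<tau> c] \<beta>])
  also have "(\<Sum>a\<in>\<mu>. of_nat (card \<nu>) * ?e a) = of_nat (card \<mu>) * of_nat (card \<nu>) * c \<mu>"
    using lin_comb_eval[OF group_axioms finite_carrier \<mu>] by simp
  finally show ?thesis
    using sums_divide[of _ _ "of_nat (order G) :: complex"]
    by (simp add: hurwitz_eq[OF \<mu> \<nu> \<tau>] sum_distrib_right[symmetric])
qed

end

theorem theorem5p3:
  fixes G :: "('a, 'b) monoid_scheme"
    and \<mu> \<nu> \<tau> :: "'a set"
  assumes "group G" and "finite (carrier G)"
    and "\<mu> \<in> conj_classes G" and "\<nu> \<in> conj_classes G" and "\<tau> \<in> conj_classes G"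
  shows "\<forall>\<^sub>F \<beta> in nhds (0 :: complex).
      integrable (dm G) (\<lambda>z. gauss G \<tau> \<beta> z) \<and>
      integrable (dm G) (\<lambda>z. coord \<mu> z * cnj (coord \<nu> z) * gauss G \<tau> \<beta> z) \<and>
      partition_fun G \<tau> \<beta> \<noteq> 0 \<and>
      (\<lambda>r. hurwitz G \<tau> \<mu> \<nu> r * \<beta> ^ r) sums
        (1 / partition_fun G \<tau> \<beta> *
         (tr G (conv G (class_fun (inv_class G \<mu>)) (class_fun \<mu>)) *
          tr G (conv G (class_fun (inv_class G \<nu>)) (class_fun \<nu>)) / of_nat (order G)) *
         (LINT z|dm G. coord \<mu> z * cnj (coord \<nu> z) * gauss G \<tau> \<beta> z))"
proof -
  interpret finite_group G
    using assms(1,2) by (simp add: finite_group_def finite_group_axioms_def)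
  let ?I = "conj_classes G"
  let ?M = "\<Pi>\<^sub>M \<mu>\<in>?I. lborel :: complex measure"
  let ?t = "\<lambda>\<kappa> \<rho>. \<Sum>a\<in>\<kappa>. conv G (class_fun \<tau>) (class_fun \<rho>) a"
  let ?a = "\<lambda>\<beta> \<kappa> \<rho>. (if \<kappa> = \<rho> then of_real (real (card \<kappa>)) else 0) - \<beta> * ?t \<kappa> \<rho>"
  note coord = coord_lin_comb[OF assms(1,2)]
  \<comment> \<open>The two matrices are compared only through their forms, which read just the
    entries indexed by conjugacy classes, where \<open>A_matrix_eq\<close> applies.\<close>
  have herm: "hermitian_sum ?I (A_matrix G \<tau> \<beta>) = hermitian_sum ?I (?a \<beta>)" for \<beta>
    using A_matrix_eq[OF _ _ assms(5)] by (simp add: hermitian_sum_def fun_eq_iff)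
  have "\<forall>\<^sub>F \<beta> in nhds 0. coercive_form ?I (?a \<beta>) (1 / 2) \<and>
      (LINT z|?M. gaussian_weight ?I (?a \<beta>) z) \<noteq> 0"
  proof (rule eventually_coercive_and_integral_neq_0[OF conj_classes_finite])
    show "real (card \<kappa>) \<ge> 1" if "\<kappa> \<in> ?I" for \<kappa>
      using conj_class_card_pos[OF that] by linarith
  qed
  \<comment> \<open>This second smallness condition is the one for convergence of the Neumann
    series.\<close>
  moreover have "\<forall>\<^sub>F \<beta> in nhds (0::complex). norm \<beta> * of_nat (order G) < 1"
  proof (rule order_tendstoD(2))
    show "((\<lambda>\<beta>::complex. norm \<beta> * of_nat (order G)) \<longlongrightarrow> norm (0::complex) * of_nat (order G)) (nhds 0)"
      by (intro tendsto_intros filterlim_ident)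
  qed simp
  ultimately show ?thesis
  proof eventually_elim
    case (elim \<beta>)
    let ?W = "gaussian_weight ?I (A_matrix G \<tau> \<beta>)"
    have W: "?W = gaussian_weight ?I (?a \<beta>)"
      by (simp add: gaussian_weight_def fun_eq_iff herm)
    interpret coercive_form ?I "A_matrix G \<tau> \<beta>" "1 / 2"
      using elim by (simp add: coercive_form_def herm)
    define Z where "Z = (LINT z|?M. ?W z)"
    define E where "E \<kappa> = (LINT z|?M. z \<kappa> * cnj (z \<nu>) * ?W z)" for \<kappa>
    have Z: "Z \<noteq> 0" using elim by (simp add: Z_def W)
    have "(\<lambda>c. gauss G \<tau> \<beta> (lin_comb G c)) \<in> borel_measurable ?M"
      unfolding gauss_lin_comb by measurable
    note gauss = integral_dm[OF this] integrable_dm[OF this]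
    have "(\<lambda>c. coord \<mu> (lin_comb G c) * cnj (coord \<nu> (lin_comb G c)) * gauss G \<tau> \<beta> (lin_comb G c))
        \<in> borel_measurable ?M"
      unfolding gauss_lin_comb coord[OF assms(3)] coord[OF assms(4)] using assms(3,4) by measurable
    note moment = integral_dm[OF this] integrable_dm[OF this]
    have part: "partition_fun G \<tau> \<beta> = Z"
      by (simp add: partition_fun_def gauss gauss_lin_comb Z_def)
    \<comment> \<open>Division by \<open>Z\<close> normalizes column \<open>\<nu>\<close> of the
      moment matrix to a solution of the system with right-hand side the unit vector at
      \<open>\<nu>\<close>.\<close>
    have "(\<Sum>\<rho>\<in>?I. A_matrix G \<tau> \<beta> \<kappa> \<rho> * (E \<rho> / Z)) = (if \<kappa> = \<nu> then 1 else 0)"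
      if "\<kappa> \<in> ?I" for \<kappa>
      using second_moments[OF that assms(4)] Z
      by (simp add: E_def Z_def sum_divide_distrib[symmetric])
    from sums_hurwitz[OF assms(3-5) this] elim
    have "(\<lambda>r. hurwitz G \<tau> \<mu> \<nu> r * \<beta> ^ r) sums
        (of_nat (card \<mu>) * of_nat (card \<nu>) / of_nat (order G) * (E \<mu> / Z))" by simp
    moreover have "tr G (conv G (class_fun (inv_class G \<kappa>)) (class_fun \<kappa>)) = of_nat (card \<kappa>)"
      if "\<kappa> \<in> ?I" for \<kappa>
      using that by (simp add: tr_conv_inv_class)
    moreover have "(LINT z|dm G. coord \<mu> z * cnj (coord \<nu> z) * gauss G \<tau> \<beta> z) = E \<mu>"
      by (simp add: moment gauss_lin_comb coord assms(3,4) E_def)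
    moreover have "integrable (dm G) (gauss G \<tau> \<beta>)"
      using integrable_weight by (simp add: gauss gauss_lin_comb)
    moreover have "integrable (dm G) (\<lambda>z. coord \<mu> z * cnj (coord \<nu> z) * gauss G \<tau> \<beta> z)"
      using integrable_moments(1)[OF assms(3,4)]
      by (simp add: moment gauss_lin_comb coord assms(3,4))
    ultimately show ?case
      using Z assms(3,4) by (simp add: part mult_ac)
  qed
qed

end
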